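(* Let $k$ be a field of characteristic zero and let $A=k\langle x,y\rangle/\langle x^2,\,y^2-xy\rangle$. The higher Koszul homology of $A$ is given by: 1. $HK^{hi}_0(A)\cong k$; 2. $HK^{hi}_1(A)\cong0$; 3. $HK^{hi}_2(A)$ is $2$-dimensional, generated by the classes of $[yx\otimes x^2+(xy+yx)\otimes(y^2-xy)]$ and $[xyx\otimes(y^2-xy)]$, where $[z]\in HK_2(A)$ denotes the Koszul homology class of a cycle $z\in A\otimes R$; 4. $HK^{hi}_p(A)\cong0$ for any $p\ge3$.
   Context: Here $A=T(V)/(R)$ with $V=k.x\oplus k.y$ and $R\subseteq V\otimes V$ spanned by $x^2=x\otimes x$ and $y^2-xy=y\otimes y-x\otimes y$. For a quadratic algebra $A=T(V)/(R)$: $W_0=k$, $W_1=V$, $W_p=\bigcap_{i+2+j=p}V^{\otimes i}\otimes R\otimes V^{\otimes j}$ for $p\ge2$. Elements of $W_p$ are written $x_1\ldots x_p$ (a sum of such tensors, $x_i\in V$). Koszul homology $HK_\bullet(A)$ is the homology of $(A\otimes W_\bullet,b_K)$, $b_K(a\otimes x_1\ldots x_p)=ax_1\otimes x_2\ldots x_p+(-1)^px_pa\otimes x_1\ldots x_{p-1}$ (and $0$ for $p=0$). Let $e_A\frown_K(a\otimes x_1\ldots x_p)=(-1)^{p-1}x_pa\otimes x_1\ldots x_{p-1}$ ($0$ for $p=0$). It induces a differential $\partial_\frown:HK_p(A)\to HK_{p-1}(A)$, and the higher Koszul homology $HK^{hi}_\bullet(A)$ is the homology of $(HK_\bullet(A),\partial_\frown)$.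 *)

theory Defs
  imports
    "Jordan_Normal_Form.Missing_VectorSpace"
    "HOL-Algebra.QuotRing"
    "HOL-Algebra.Algebraic_Closure_Type"
    "HOL-Library.Poly_Mapping"
begin

section \<open>Vector spaces: quotients, isomorphism, homology\<close>

abbreviation scalars :: "'k::field ring" where
  "scalars \<equiv> ring_of_type_algebra"

definition line_space :: "('k::field, 'k) module" where
  "line_space = \<lparr>carrier = UNIV, monoid.mult = (*), one = 1, ring.zero = 0, add = (+), module.smult = (*)\<rparr>"

definition zero_space :: "('k::field, 'k) module" where
  "zero_space = line_space\<lparr>carrier := {0}\<rparr>"

definition vs_iso :: "('k::field, 'a, 'm) module_scheme \<Rightarrow> ('k, 'b, 'n) module_scheme \<Rightarrow> bool" where
  "vs_iso V W \<longleftrightarrow> (\<exists>T. linear_map scalars V W T \<and> bij_betw T (carrier V) (carrier W))"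

text \<open>This is \<^const>\<open>FactRing\<close> together with the induced scalar multiplication. It is used for the
  quotient of an algebra by an ideal and for the quotient of a vector space by a subspace; in the
  latter case the fields \<^const>\<open>monoid.mult\<close> and \<^const>\<open>one\<close> carry no information.\<close>

definition mod_quot :: "('k, 'a, 'm) module_scheme \<Rightarrow> 'a set \<Rightarrow> ('k, 'a set) module" where
  "mod_quot M N =
    \<lparr>carrier = a_rcosets\<^bsub>M\<^esub> N, monoid.mult = rcoset_mult M N, one = N +>\<^bsub>M\<^esub> \<one>\<^bsub>M\<^esub>,
     ring.zero = N, add = set_add M, module.smult = (\<lambda>c S. \<Union>s\<in>S. N +>\<^bsub>M\<^esub> (c \<odot>\<^bsub>M\<^esub> s))\<rparr>"

text \<open>A complex has spaces \<open>C p\<close> and differentials \<open>d p\<close> from \<open>C p\<close> to \<open>C (p - 1)\<close>. The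
  differential in degree \<open>0\<close> is always the zero map; as \<open>0 - 1 = 0\<close>, it is formally a map from
  \<open>C 0\<close> to itself.\<close>

definition cycles ::
  "(nat \<Rightarrow> ('k, 'a) module) \<Rightarrow> (nat \<Rightarrow> 'a \<Rightarrow> 'a) \<Rightarrow> nat \<Rightarrow> ('k, 'a) module" where
  "cycles C d p = (C p)\<lparr>carrier := {z \<in> carrier (C p). d p z = \<zero>\<^bsub>C (p - 1)\<^esub>}\<rparr>"

definition boundaries ::
  "(nat \<Rightarrow> ('k, 'a) module) \<Rightarrow> (nat \<Rightarrow> 'a \<Rightarrow> 'a) \<Rightarrow> nat \<Rightarrow> 'a set" where
  "boundaries C d p = d (Suc p) ` carrier (C (Suc p))"

definition homology ::
  "(nat \<Rightarrow> ('k, 'a) module) \<Rightarrow> (nat \<Rightarrow> 'a \<Rightarrow> 'a) \<Rightarrow> nat \<Rightarrow> ('k, 'a set) module" where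
  "homology C d p = mod_quot (cycles C d p) (boundaries C d p)"

definition homology_class ::
  "(nat \<Rightarrow> ('k, 'a) module) \<Rightarrow> (nat \<Rightarrow> 'a \<Rightarrow> 'a) \<Rightarrow> nat \<Rightarrow> 'a \<Rightarrow> 'a set" where
  "homology_class C d p z = boundaries C d p +>\<^bsub>C p\<^esub> z"


section \<open>The tensor algebra\<close>

text \<open>For \<open>V\<close> with basis \<open>'x\<close>, the tensor algebra \<open>T(V)\<close> is the monoid algebra of the monoid of
  words over \<open>'x\<close>. With the following instance, multiplication of \<^type>\<open>poly_mapping\<close>s is the
  convolution product.\<close>

instantiation list :: (type) monoid_add
begin

definition plus_list :: "'a list \<Rightarrow> 'a list \<Rightarrow> 'a list" where
  "plus_list = (@)"

definition zero_list :: "'a list" where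
  "zero_list = []"

instance
  by standard (simp_all add: plus_list_def zero_list_def)

end

type_synonym ('x, 'k) tensor = "'x list \<Rightarrow>\<^sub>0 'k"

definition word :: "'x list \<Rightarrow> ('x, 'k::field) tensor" where
  "word w = Poly_Mapping.single w 1"

definition tensor_algebra :: "('k::field, ('x, 'k) tensor) module" where
  "tensor_algebra =
    \<lparr>carrier = UNIV, monoid.mult = (*), one = 1, ring.zero = 0, add = (+),
     module.smult = (\<lambda>c u. Poly_Mapping.single [] c * u)\<rparr>"

definition tensor_power :: "nat \<Rightarrow> ('x, 'k::field) tensor set" where
  "tensor_power p = {u. \<forall>w \<in> Poly_Mapping.keys u. length w = p}"

abbreviation tensor_span :: "('x, 'k::field) tensor set \<Rightarrow> ('x, 'k) tensor set" where
  "tensor_span \<equiv> LinearCombinations.module.span scalars tensor_algebra"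


section \<open>Quadratic algebras and Koszul homology\<close>

text \<open>Throughout, \<open>R\<close> is a subspace of \<open>tensor_power 2\<close>.\<close>

definition quadratic_algebra ::
  "('x, 'k::field) tensor set \<Rightarrow> ('k, ('x, 'k) tensor set) module" where
  "quadratic_algebra R = mod_quot tensor_algebra (Idl\<^bsub>tensor_algebra\<^esub> R)"

definition alg_class :: "('x, 'k::field) tensor set \<Rightarrow> ('x, 'k) tensor \<Rightarrow> ('x, 'k) tensor set" where
  "alg_class R u = (Idl\<^bsub>tensor_algebra\<^esub> R) +>\<^bsub>tensor_algebra\<^esub> u"

definition koszul_W :: "('x, 'k::field) tensor set \<Rightarrow> nat \<Rightarrow> ('x, 'k) tensor set" where
  "koszul_W R p =
    (if p < 2 then tensor_power p
     else \<Inter>i \<in> {..p - 2}.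
       tensor_span {u * r * v | u r v.
         u \<in> tensor_power i \<and> r \<in> R \<and> v \<in> tensor_power (p - 2 - i)})"

text \<open>The space \<open>A \<otimes> V\<^sup>\<otimes>\<^sup>p\<close>, for \<open>A = quadratic_algebra R\<close>: since the words of length \<open>p\<close> form a
  basis of \<open>V\<^sup>\<otimes>\<^sup>p\<close>, an element is uniquely of the form \<open>\<Sum>w. f w \<otimes> w\<close>, and it is represented by its
  coefficient function \<open>f\<close>.\<close>

definition tensor_chains ::
  "('x::finite, 'k::field) tensor set \<Rightarrow> nat \<Rightarrow> ('k, 'x list \<Rightarrow> ('x, 'k) tensor set) module" where
  "tensor_chains R p =
    \<lparr>carrier = {f. (\<forall>w. f w \<in> carrier (quadratic_algebra R)) \<and>
                  (\<forall>w. length w \<noteq> p \<longrightarrow> f w = \<zero>\<^bsub>quadratic_algebra R\<^esub>)},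
     monoid.mult = undefined, one = undefined,
     ring.zero = (\<lambda>w. \<zero>\<^bsub>quadratic_algebra R\<^esub>),
     add = (\<lambda>f g w. f w \<oplus>\<^bsub>quadratic_algebra R\<^esub> g w),
     module.smult = (\<lambda>c f w. c \<odot>\<^bsub>quadratic_algebra R\<^esub> f w)\<rparr>"

text \<open>The pure tensor \<open>a \<otimes> u\<close>.\<close>

definition pure_tensor ::
  "('x, 'k::field) tensor set \<Rightarrow> ('x, 'k) tensor set \<Rightarrow> ('x, 'k) tensor
    \<Rightarrow> 'x list \<Rightarrow> ('x, 'k) tensor set" where
  "pure_tensor R a u = (\<lambda>w. Poly_Mapping.lookup u w \<odot>\<^bsub>quadratic_algebra R\<^esub> a)"

text \<open>\<open>A \<otimes> W\<^sub>p\<close> as a subspace of \<open>A \<otimes> V\<^sup>\<otimes>\<^sup>p\<close>.\<close>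

definition koszul_chains ::
  "('x::finite, 'k::field) tensor set \<Rightarrow> nat \<Rightarrow> ('k, 'x list \<Rightarrow> ('x, 'k) tensor set) module" where
  "koszul_chains R p = (tensor_chains R p)\<lparr>carrier :=
     LinearCombinations.module.span scalars (tensor_chains R p)
       {pure_tensor R a u | a u. a \<in> carrier (quadratic_algebra R) \<and> u \<in> koszul_W R p}\<rparr>"

text \<open>Both maps are given on \<open>a \<otimes> x\<^sub>1 \<dots> x\<^sub>p\<close>, for a word \<open>x\<^sub>1 \<dots> x\<^sub>p\<close>, by the usual formulas and
  extended linearly to \<open>\<Sum>w. f w \<otimes> w\<close>.\<close>

definition koszul_b ::
  "('x::finite, 'k::field) tensor set \<Rightarrow> nat \<Rightarrow> ('x list \<Rightarrow> ('x, 'k) tensor set)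
    \<Rightarrow> ('x list \<Rightarrow> ('x, 'k) tensor set)" where
  "koszul_b R p f =
    (if p = 0 then \<zero>\<^bsub>tensor_chains R 0\<^esub>
     else \<Oplus>\<^bsub>tensor_chains R (p - 1)\<^esub> w \<in> {w. length w = p}.
       pure_tensor R (f w \<otimes>\<^bsub>quadratic_algebra R\<^esub> alg_class R (word [hd w])) (word (tl w))
       \<oplus>\<^bsub>tensor_chains R (p - 1)\<^esub>
       (- 1) ^ p \<odot>\<^bsub>tensor_chains R (p - 1)\<^esub>
         pure_tensor R (alg_class R (word [last w]) \<otimes>\<^bsub>quadratic_algebra R\<^esub> f w) (word (butlast w)))"

definition koszul_cap ::
  "('x::finite, 'k::field) tensor set \<Rightarrow> nat \<Rightarrow> ('x list \<Rightarrow> ('x, 'k) tensor set)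
    \<Rightarrow> ('x list \<Rightarrow> ('x, 'k) tensor set)" where
  "koszul_cap R p f =
    (if p = 0 then \<zero>\<^bsub>tensor_chains R 0\<^esub>
     else \<Oplus>\<^bsub>tensor_chains R (p - 1)\<^esub> w \<in> {w. length w = p}.
       (- 1) ^ (p - 1) \<odot>\<^bsub>tensor_chains R (p - 1)\<^esub>
         pure_tensor R (alg_class R (word [last w]) \<otimes>\<^bsub>quadratic_algebra R\<^esub> f w) (word (butlast w)))"

abbreviation HK ::
  "('x::finite, 'k::field) tensor set \<Rightarrow> nat \<Rightarrow> ('k, ('x list \<Rightarrow> ('x, 'k) tensor set) set) module" where
  "HK R \<equiv> homology (koszul_chains R) (koszul_b R)"

abbreviation HK_class ::
  "('x::finite, 'k::field) tensor set \<Rightarrow> nat \<Rightarrow> ('x list \<Rightarrow> ('x, 'k) tensor set)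
    \<Rightarrow> ('x list \<Rightarrow> ('x, 'k) tensor set) set" where
  "HK_class R \<equiv> homology_class (koszul_chains R) (koszul_b R)"

text \<open>The map induced by \<^const>\<open>koszul_cap\<close> on Koszul homology: the classes of the images of all
  representatives coincide, so their union is that class.\<close>

definition HK_cap ::
  "('x::finite, 'k::field) tensor set \<Rightarrow> nat \<Rightarrow> ('x list \<Rightarrow> ('x, 'k) tensor set) set
    \<Rightarrow> ('x list \<Rightarrow> ('x, 'k) tensor set) set" where
  "HK_cap R p c = (\<Union>z\<in>c. HK_class R (p - 1) (koszul_cap R p z))"

abbreviation HKhi ::
  "('x::finite, 'k::field) tensor set \<Rightarrow> nat
    \<Rightarrow> ('k, ('x list \<Rightarrow> ('x, 'k) tensor set) set set) module" where
  "HKhi R \<equiv> homology (HK R) (HK_cap R)"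

abbreviation HKhi_class ::
  "('x::finite, 'k::field) tensor set \<Rightarrow> nat \<Rightarrow> ('x list \<Rightarrow> ('x, 'k) tensor set) set
    \<Rightarrow> ('x list \<Rightarrow> ('x, 'k) tensor set) set set" where
  "HKhi_class R \<equiv> homology_class (HK R) (HK_cap R)"


section \<open>The algebra \<open>k\<langle>x, y\<rangle> / \<langle>x\<^sup>2, y\<^sup>2 - xy\<rangle>\<close>\<close>

datatype gen = Gx | Gy

instance gen :: finite
proof
  have "(UNIV :: gen set) = {Gx, Gy}"
    using gen.exhaust by auto
  then show "finite (UNIV :: gen set)"
    by (metis finite.emptyI finite.insertI)
qed

definition rels :: "(gen, 'k::field) tensor set" where
  "rels = tensor_span {word [Gx, Gx], word [Gy, Gy] - word [Gx, Gy]}"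

definition z1 :: "gen list \<Rightarrow> (gen, 'k::field) tensor set" where
  "z1 = pure_tensor rels (alg_class rels (word [Gy, Gx])) (word [Gx, Gx])
    \<oplus>\<^bsub>tensor_chains rels 2\<^esub>
    pure_tensor rels (alg_class rels (word [Gx, Gy] + word [Gy, Gx])) (word [Gy, Gy] - word [Gx, Gy])"

definition z2 :: "gen list \<Rightarrow> (gen, 'k::field) tensor set" where
  "z2 = pure_tensor rels (alg_class rels (word [Gx, Gy, Gx])) (word [Gy, Gy] - word [Gx, Gy])"

end

theory Submission
  imports Defs "HOL-Library.Product_Plus" "HOL-Library.Function_Algebras"
begin

text \<open>The algebra has the basis \<open>1, x, y, xy, yx, xyx\<close>, and \<open>W\<^sub>p\<close> is spanned by \<open>x\<^sup>p\<close> for \<open>p \<ge> 3\<close>. Writing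
  \<open>L\<close> and \<open>R\<close> for the left and right multiplication by \<open>x\<close>, the differentials in degree \<open>p \<ge> 3\<close> are
  \<open>R - (-1)\<^sup>p\<^sup>-\<^sup>1 L\<close> and \<open>(-1)\<^sup>p\<^sup>-\<^sup>1 L\<close> on a six-dimensional space. There \<open>HK\<^sub>p\<close> is spanned by the class of
  \<open>1 \<otimes> x\<^sup>p\<close> for odd \<open>p\<close> and of \<open>x \<otimes> x\<^sup>p\<close> for even \<open>p\<close>, and the cap product maps the former isomorphically
  to \<open>HK\<^sub>p\<^sub>-\<^sub>1\<close>. In low degrees \<open>HK\<^sub>0\<close>, \<open>HK\<^sub>1\<close>, \<open>HK\<^sub>2\<close> have dimensions 4, 3, 3, the cap product
  is injective on \<open>HK\<^sub>1\<close> with image the classes of \<open>x, y, xy\<close>, and it hits only \<open>x \<otimes> x\<^sup>2\<close> in \<open>HK\<^sub>2\<close>.\<close>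

section \<open>Presented vector spaces and their homology\<close>

text \<open>An element of the higher Koszul homology is a set of sets of functions whose values are
  cosets. The proof therefore keeps every space as a quotient S / K inside a concrete coordinate
  space. If a map \<open>\<delta>\<close> lifts the differential, homology is again of this form:
  the representatives are the v with \<open>\<delta>\<close> v in K, taken modulo K +
  \<open>\<delta>\<close> S. After two rounds only linear equations between six-tuples remain.

  Both differentials come from two maps: b_K = r - cap, where r moves the first letter of the word.
  The maps r and cap square to zero and anticommute, so cap descends to homology.

  Characteristic zero provides the inverses of 2 and 3. The 2 comes from b_K(1 \<otimes> x^p) = 2x
  \<otimes> x^(p-1) for even p. The 3 is, up to sign, the determinant of b_K on the coefficients x
  and y of y^2 - xy in degree 2.

  The two classes in degree 2 survive because W_3 is a line: everything arriving from degree 3 lies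
  in A \<otimes> x^2 and cannot reach the summand A \<otimes> (y^2 - xy).\<close>

lemma scalars_simps [simp]:
  "carrier scalars = (UNIV :: 'k::field set)"
  "x \<otimes>\<^bsub>scalars\<^esub> y = x * (y :: 'k)"
  "x \<oplus>\<^bsub>scalars\<^esub> y = x + (y :: 'k)"
  "\<one>\<^bsub>scalars\<^esub> = (1 :: 'k)"
  "\<zero>\<^bsub>scalars\<^esub> = (0 :: 'k)"
  by (simp_all add: ring_of_type_algebra_def)

text \<open>\<open>q\<close> presents \<open>H\<close> as \<open>S / K\<close>. Quotients and homology of presented spaces are again presented, so
  that iterated homology, whose elements are sets of sets, is computed inside the single type \<open>'v\<close>.\<close>

locale presentation = vector_space scale
  for scale :: "'k::field \<Rightarrow> 'v::ab_group_add \<Rightarrow> 'v" +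
  fixes H :: "('k, 'h, 'm) module_scheme" and S K :: "'v set" and q :: "'v \<Rightarrow> 'h"
  assumes zero_S: "0 \<in> S"
    and add_S: "v \<in> S \<Longrightarrow> w \<in> S \<Longrightarrow> v + w \<in> S"
    and scale_S: "v \<in> S \<Longrightarrow> scale c v \<in> S"
    and image: "q ` S = carrier H"
    and q_add: "v \<in> S \<Longrightarrow> w \<in> S \<Longrightarrow> q (v + w) = q v \<oplus>\<^bsub>H\<^esub> q w"
    and q_scale: "v \<in> S \<Longrightarrow> q (scale c v) = c \<odot>\<^bsub>H\<^esub> q v"
    and q_zero: "q 0 = \<zero>\<^bsub>H\<^esub>"
    and kernel: "{v \<in> S. q v = \<zero>\<^bsub>H\<^esub>} = K"
begin

lemma uminus_S: "v \<in> S \<Longrightarrow> - v \<in> S"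
  using scale_S[of v "-1"] by simp

lemma diff_S: "v \<in> S \<Longrightarrow> w \<in> S \<Longrightarrow> v - w \<in> S"
  using add_S[of v "- w"] uminus_S by simp

lemma q_closed: "v \<in> S \<Longrightarrow> q v \<in> carrier H"
  using image by blast

lemma kernelD: "v \<in> K \<Longrightarrow> v \<in> S" "v \<in> K \<Longrightarrow> q v = \<zero>\<^bsub>H\<^esub>"
  using kernel by blast+

lemma kernelI: "v \<in> S \<Longrightarrow> q v = \<zero>\<^bsub>H\<^esub> \<Longrightarrow> v \<in> K"
  using kernel by blast

lemma zero_K: "0 \<in> K"
  by (simp add: kernelI zero_S q_zero)

lemma add_K: "v \<in> K \<Longrightarrow> w \<in> K \<Longrightarrow> v + w \<in> K"
  using q_add[OF zero_S zero_S] q_zero by (intro kernelI) (simp_all add: kernelD add_S q_add)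

lemma scale_K: "v \<in> K \<Longrightarrow> scale c v \<in> K"
  using q_scale[OF zero_S, of c] q_zero by (intro kernelI) (simp_all add: kernelD scale_S q_scale)

text \<open>\<open>H\<close> is a bare record with no axioms assumed. Each of its elements is
  \<open>q v\<close> with v in \<open>S\<close>, so every module axiom is the image under
  \<open>q\<close> of an identity in the ambient vector space.\<close>

lemma module_H: "Module.module scalars H"
proof -
  have *: "\<exists>v\<in>S. x = q v" if "x \<in> carrier H" for x
    using that image by blast
  have "abelian_group H"
  proof (rule abelian_groupI)
    fix x y assume "x \<in> carrier H" "y \<in> carrier H"
    then show "x \<oplus>\<^bsub>H\<^esub> y \<in> carrier H"
      using * q_add add_S q_closed by metis
  next
    show "\<zero>\<^bsub>H\<^esub> \<in> carrier H"
      using q_closed[OF zero_S] q_zero by simp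
  next
    fix x y z assume "x \<in> carrier H" "y \<in> carrier H" "z \<in> carrier H"
    then obtain u v w where "u \<in> S" "v \<in> S" "w \<in> S" "x = q u" "y = q v" "z = q w"
      using * by metis
    then show "x \<oplus>\<^bsub>H\<^esub> y \<oplus>\<^bsub>H\<^esub> z = x \<oplus>\<^bsub>H\<^esub> (y \<oplus>\<^bsub>H\<^esub> z)"
      using q_add add_S by (metis add.assoc)
  next
    fix x y assume "x \<in> carrier H" "y \<in> carrier H"
    then show "x \<oplus>\<^bsub>H\<^esub> y = y \<oplus>\<^bsub>H\<^esub> x"
      using * q_add by (metis add.commute)
  next
    fix x assume "x \<in> carrier H"
    then obtain v where v: "v \<in> S" "x = q v"
      using * by blast
    show "\<zero>\<^bsub>H\<^esub> \<oplus>\<^bsub>H\<^esub> x = x"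
      using q_add[OF zero_S v(1)] v q_zero by simp
    show "\<exists>y\<in>carrier H. y \<oplus>\<^bsub>H\<^esub> x = \<zero>\<^bsub>H\<^esub>"
      using q_add[OF uminus_S[OF v(1)] v(1)] v q_zero q_closed[OF uminus_S[OF v(1)]] by auto
  qed
  then show ?thesis
  proof (rule moduleI[OF cring_from_type_algebra])
    fix a x assume "x \<in> carrier H"
    then show "a \<odot>\<^bsub>H\<^esub> x \<in> carrier H"
      using * q_scale scale_S q_closed by metis
  next
    fix a b x assume "x \<in> carrier H"
    then obtain v where v: "v \<in> S" "x = q v"
      using * by blast
    then show "(a \<oplus>\<^bsub>scalars\<^esub> b) \<odot>\<^bsub>H\<^esub> x = a \<odot>\<^bsub>H\<^esub> x \<oplus>\<^bsub>H\<^esub> b \<odot>\<^bsub>H\<^esub> x"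
      by (simp flip: q_scale q_add add: scale_S scale_left_distrib)
    show "a \<otimes>\<^bsub>scalars\<^esub> b \<odot>\<^bsub>H\<^esub> x = a \<odot>\<^bsub>H\<^esub> (b \<odot>\<^bsub>H\<^esub> x)"
      using v by (simp flip: q_scale add: scale_S)
  next
    fix a x y assume "x \<in> carrier H" "y \<in> carrier H"
    then obtain v w where "v \<in> S" "x = q v" "w \<in> S" "y = q w"
      using * by metis
    then show "a \<odot>\<^bsub>H\<^esub> (x \<oplus>\<^bsub>H\<^esub> y) = a \<odot>\<^bsub>H\<^esub> x \<oplus>\<^bsub>H\<^esub> a \<odot>\<^bsub>H\<^esub> y"
      by (simp flip: q_scale q_add add: scale_S add_S scale_right_distrib)
  next
    fix x assume "x \<in> carrier H"
    then obtain v where v: "v \<in> S" "x = q v"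
      using * by blast
    then show "\<one>\<^bsub>scalars\<^esub> \<odot>\<^bsub>H\<^esub> x = x"
      by (simp flip: q_scale)
  qed
qed

lemma vectorspace_H: "vectorspace scalars H"
  using module_H field_from_type_algebra by (simp add: vectorspace_def)

sublocale H: vectorspace scalars H
  by (rule vectorspace_H)

lemma q_eq_iff:
  assumes "v \<in> S" "w \<in> S"
  shows "q v = q w \<longleftrightarrow> v - w \<in> K"
proof
  have q: "q v = q (v - w) \<oplus>\<^bsub>H\<^esub> q w"
    using q_add[OF diff_S[OF assms] assms(2)] by simp
  show "v - w \<in> K" if "q v = q w"
    using that q q_closed[OF assms(2)] q_closed[OF diff_S[OF assms]] diff_S[OF assms]
    by (metis H.add.r_cancel_one' kernelI)
  show "q v = q w" if "v - w \<in> K"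
    using that q q_closed[OF assms(2)] by (simp add: kernelD)
qed

lemma q_finsum:
  assumes "finite I" "\<And>i. i \<in> I \<Longrightarrow> v i \<in> S"
  shows "finsum H (\<lambda>i. q (v i)) I = q (\<Sum>i\<in>I. v i) \<and> (\<Sum>i\<in>I. v i) \<in> S"
  using assms
proof (induction I rule: finite_induct)
  case empty
  then show ?case
    by (simp add: q_zero zero_S)
next
  case (insert i I)
  then have "(\<lambda>i. q (v i)) \<in> I \<rightarrow> carrier H" "q (v i) \<in> carrier H"
    by (auto intro: q_closed)
  with insert show ?case
    by (simp add: q_add add_S)
qed

text \<open>This makes presentations stable under iteration: passing to a quotient of
  \<open>H\<close> enlarges the kernel from \<open>K\<close> to \<open>L\<close> and leaves the
  representatives \<open>S\<close> unchanged.\<close>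

lemma quotient:
  assumes L: "K \<subseteq> L" "L \<subseteq> S"
    and L_add: "\<And>v w. v \<in> L \<Longrightarrow> w \<in> L \<Longrightarrow> v + w \<in> L"
    and L_scale: "\<And>c v. v \<in> L \<Longrightarrow> scale c v \<in> L"
  shows "presentation scale (mod_quot H (q ` L)) S L (\<lambda>v. q ` L +>\<^bsub>H\<^esub> q v)"
proof -
  have L_zero: "0 \<in> L"
    using zero_K L by blast
  have L_diff: "v - w \<in> L" if "v \<in> L" "w \<in> L" for v w
    using L_add[of v "scale (- 1) w"] L_scale[of w "- 1"] that by simp
  \<comment> \<open>The coset of \<open>q v\<close> is the image of the translate L + v. In this
    form the setwise operations of \<open>mod_quot\<close> become computations with vectors.\<close>
  define C where "C v = q ` ((\<lambda>l. l + v) ` L)" for v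
  have coset: "q ` L +>\<^bsub>H\<^esub> q v = C v" if "v \<in> S" for v
    unfolding C_def a_r_coset_def' using that L(2) by (force simp: q_add)
  have C_add: "set_add H (C v) (C w) = C (v + w)" if "v \<in> S" "w \<in> S" for v w
  proof
    show "C v <+>\<^bsub>H\<^esub> C w \<subseteq> C (v + w)"
    proof
      fix x assume "x \<in> C v <+>\<^bsub>H\<^esub> C w"
      then obtain l m where "l \<in> L" "m \<in> L" and x: "x = q (l + v) \<oplus>\<^bsub>H\<^esub> q (m + w)"
        unfolding C_def set_add_def' by auto
      then have "x = q ((l + m) + (v + w))" "l + m \<in> L"
        using that L(2) L_add by (auto simp flip: q_add simp: add_S algebra_simps subset_iff)
      then show "x \<in> C (v + w)"
        unfolding C_def by blast
    qed
    show "C (v + w) \<subseteq> C v <+>\<^bsub>H\<^esub> C w"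
    proof
      fix x assume "x \<in> C (v + w)"
      then obtain l where l: "l \<in> L" "x = q ((l + v) + (0 + w))"
        unfolding C_def by (auto simp: algebra_simps)
      then have "x = q (l + v) \<oplus>\<^bsub>H\<^esub> q (0 + w)"
        using that L(2) by (subst q_add[symmetric]) (auto simp: add_S)
      then show "x \<in> C v <+>\<^bsub>H\<^esub> C w"
        unfolding C_def set_add_def' using l(1) L_zero by blast
    qed
  qed
  have C_eq: "C v = C w" if "v \<in> S" "w \<in> S" "v - w \<in> L" for v w
  proof -
    have "C v \<subseteq> C w" if "v - w \<in> L" for v w
    proof
      fix x assume "x \<in> C v"
      then obtain l where "l \<in> L" "x = q ((l + (v - w)) + w)"
        unfolding C_def by auto
      then show "x \<in> C w"
        unfolding C_def using that L_add by blast
    qed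
    then show ?thesis
      using that L_diff[OF L_zero, of "v - w"] by (metis minus_diff_eq diff_0 subset_antisym)
  qed
  have C_zero: "C 0 = q ` L"
    unfolding C_def by simp
  show ?thesis
  proof
    show "0 \<in> S" by (rule zero_S)
    fix v w c assume v: "v \<in> S"
    show "scale c v \<in> S" using v by (rule scale_S)
    \<comment> \<open>Scalar multiplication in \<open>mod_quot\<close> is a union over a whole
      coset. Its members differ by elements of \<open>L\<close>, so all the cosets in the union
      coincide.\<close>
    have "(\<Union>s\<in>C v. q ` L +>\<^bsub>H\<^esub> (c \<odot>\<^bsub>H\<^esub> s)) = (\<Union>l\<in>L. C (scale c l + scale c v))"
      unfolding C_def image_image UN_simps image_UN
      using v L(2) by (intro SUP_cong refl)
        (simp flip: q_scale add: coset add_S scale_S subset_iff scale_right_distrib C_def image_image)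
    also have "\<dots> = (\<Union>l\<in>L. C (scale c v))"
      using v L(2) L_scale by (intro SUP_cong refl C_eq) (auto simp: add_S scale_S subset_iff)
    also have "\<dots> = C (scale c v)"
      using L_zero by auto
    finally show "q ` L +>\<^bsub>H\<^esub> q (scale c v) = c \<odot>\<^bsub>mod_quot H (q ` L)\<^esub> (q ` L +>\<^bsub>H\<^esub> q v)"
      using v by (simp add: mod_quot_def coset scale_S)
    assume w: "w \<in> S"
    show "v + w \<in> S" using v w by (rule add_S)
    show "q ` L +>\<^bsub>H\<^esub> q (v + w) = (q ` L +>\<^bsub>H\<^esub> q v) \<oplus>\<^bsub>mod_quot H (q ` L)\<^esub> (q ` L +>\<^bsub>H\<^esub> q w)"
      using v w by (simp add: mod_quot_def coset add_S C_add)
  next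
    show "(\<lambda>v. q ` L +>\<^bsub>H\<^esub> q v) ` S = carrier (mod_quot H (q ` L))"
      unfolding mod_quot_def A_RCOSETS_def RCOSETS_def
      by (auto simp: a_r_coset_def simp flip: image)
    show "q ` L +>\<^bsub>H\<^esub> q 0 = \<zero>\<^bsub>mod_quot H (q ` L)\<^esub>"
      by (simp add: coset zero_S C_zero mod_quot_def)
    have "v \<in> L" if "v \<in> S" and Cv: "C v = q ` L" for v
    proof -
      have "q v \<in> C v"
        unfolding C_def using L_zero by force
      then obtain l where l: "l \<in> L" "q v = q l"
        unfolding Cv by (rule imageE)
      \<comment> \<open>Equality in \<open>H\<close> determines a representative only up to
        \<open>K\<close>; the inclusion of \<open>K\<close> in \<open>L\<close> absorbs the
        difference.\<close>
      then have "v - l \<in> K"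
        using that L(2) by (subst (asm) q_eq_iff) auto
      then show ?thesis
        using L_add[of "v - l" l] l L(1) by auto
    qed
    moreover have "C v = q ` L" if "v \<in> L" for v
      using that C_eq[of v 0] L(2) C_zero zero_S by auto
    ultimately show "{v \<in> S. q ` L +>\<^bsub>H\<^esub> q v = \<zero>\<^bsub>mod_quot H (q ` L)\<^esub>} = L"
      using L(2) by (auto simp: coset mod_quot_def)
  qed
qed

text \<open>This changes coordinates: along \<open>repr\<close> from tensors to six-tuples, and
  along \<open>chain\<close> from functions on words to pairs. Surjectivity is asked of the
  composite, since \<open>repr\<close> reaches only the normal forms among all tensors.\<close>

lemma reparam:
  assumes "vector_space scale'" "0 \<in> S'" "\<And>v w. v \<in> S' \<Longrightarrow> w \<in> S' \<Longrightarrow> v + w \<in> S'"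
    "\<And>c v. v \<in> S' \<Longrightarrow> scale' c v \<in> S'"
    "\<And>v w. v \<in> S' \<Longrightarrow> w \<in> S' \<Longrightarrow> t (v + w) = t v + t w"
    "\<And>c v. v \<in> S' \<Longrightarrow> t (scale' c v) = scale c (t v)"
    "t 0 = 0" "t ` S' \<subseteq> S" "q ` t ` S' = carrier H" "{v \<in> S'. t v \<in> K} = K'"
  shows "presentation scale' H S' K' (\<lambda>v. q (t v))"
proof -
  interpret V': vector_space scale' by fact
  show ?thesis
    by unfold_locales (use assms kernel in \<open>auto simp: q_add q_scale q_zero image_image image_subset_iff\<close>)
qed

lemma vs_iso_zero:
  assumes "S \<subseteq> K"
  shows "vs_iso H (zero_space :: ('k, 'k) module)"
proof -
  have H: "carrier H = {\<zero>\<^bsub>H\<^esub>}"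
    using assms image kernel zero_S q_zero by force
  \<comment> \<open>The target presents itself; this supplies its vector space axioms.\<close>
  have Z: "presentation (*) (zero_space :: ('k, 'k) module) {0} {0} id"
    by unfold_locales (auto simp: zero_space_def line_space_def algebra_simps)
  have "linear_map scalars H (zero_space :: ('k, 'k) module) (\<lambda>_. 0)"
    unfolding linear_map_def mod_hom_def mod_hom_axioms_def
    using presentation.vectorspace_H[OF Z] presentation.module_H[OF Z] vectorspace_H module_H
    by (auto simp: LinearCombinations.module_hom_def) (simp_all add: zero_space_def line_space_def)
  moreover have "bij_betw (\<lambda>_. 0) (carrier H) (carrier (zero_space :: ('k, 'k) module))"
    by (simp add: H bij_betw_def zero_space_def line_space_def)
  ultimately show ?thesis
    unfolding vs_iso_def by blast
qed

text \<open>The first isomorphism theorem for a functional: \<open>f\<close> is constant on the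
  classes modulo \<open>K\<close>, so evaluating it at any chosen representative gives an injective
  map on \<open>H\<close>, and \<open>u\<close> makes this map onto.\<close>

lemma vs_iso_line:
  assumes f_add: "\<And>v w. f (v + w) = f v + f w" and f_scale: "\<And>c v. f (scale c v) = c * f v"
    and K: "K = {v \<in> S. f v = (0 :: 'k)}" and "u \<in> S" "f u = 1"
  shows "vs_iso H (line_space :: ('k, 'k) module)"
proof -
  have f_diff: "f (v - w) = f v - f w" for v w
    using f_add[of "v - w" w] by simp
  define g where "g x = f (SOME v. v \<in> S \<and> q v = x)" for x
  have g: "g (q v) = f v" if "v \<in> S" for v
  proof -
    define w where "w = (SOME w. w \<in> S \<and> q w = q v)"
    have "w \<in> S \<and> q w = q v"
      unfolding w_def by (rule someI[of _ v]) (use that in simp)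
    then have "w - v \<in> K"
      using q_eq_iff that by blast
    then show ?thesis
      using K f_diff[of w v] by (simp add: g_def w_def)
  qed
  have Z: "presentation (*) (line_space :: ('k, 'k) module) UNIV {0} id"
    by unfold_locales (auto simp: line_space_def algebra_simps)
  have *: "\<exists>v\<in>S. x = q v" if "x \<in> carrier H" for x
    using that image by blast
  have "g (x \<oplus>\<^bsub>H\<^esub> y) = g x + g y" if xy: "x \<in> carrier H" "y \<in> carrier H" for x y
  proof -
    obtain v w where "v \<in> S" "x = q v" "w \<in> S" "y = q w"
      using *[OF xy(1)] *[OF xy(2)] by blast
    then show ?thesis
      using g[OF add_S[of v w]] by (simp add: q_add f_add g)
  qed
  moreover have "g (c \<odot>\<^bsub>H\<^esub> x) = c * g x" if x: "x \<in> carrier H" for x c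
  proof -
    obtain v where "v \<in> S" "x = q v"
      using *[OF x] by blast
    then show ?thesis
      using g[OF scale_S[of v c]] by (simp add: q_scale f_scale g)
  qed
  ultimately have "g \<in> LinearCombinations.module_hom scalars H (line_space :: ('k, 'k) module)"
    unfolding LinearCombinations.module_hom_def by (simp add: line_space_def)
  then have "linear_map scalars H (line_space :: ('k, 'k) module) g"
    unfolding linear_map_def mod_hom_def mod_hom_axioms_def
    using presentation.vectorspace_H[OF Z] presentation.module_H[OF Z] vectorspace_H module_H
    by auto
  moreover have "bij_betw g (carrier H) (carrier (line_space :: ('k, 'k) module))"
    unfolding bij_betw_def
  proof
    show "inj_on g (carrier H)"
    proof (rule inj_onI)
      fix x y assume xy: "x \<in> carrier H" "y \<in> carrier H" "g x = g y"
      obtain v w where "v \<in> S" "x = q v" "w \<in> S" "y = q w"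
        using *[OF xy(1)] *[OF xy(2)] by blast
      then show "x = y"
        using xy(3) by (simp add: g q_eq_iff K diff_S f_diff)
    qed
    have "c \<in> g ` carrier H" for c
      using g[OF scale_S[OF \<open>u \<in> S\<close>], of c] q_closed[OF scale_S[OF \<open>u \<in> S\<close>], of c] assms(5)
      by (force simp: f_scale)
    then show "g ` carrier H = carrier (line_space :: ('k, 'k) module)"
      by (auto simp: line_space_def)
  qed
  ultimately show ?thesis
    unfolding vs_iso_def by blast
qed

lemma two_dimensional:
  assumes "u \<in> S" "v \<in> S"
    and gen: "\<And>w. w \<in> S \<Longrightarrow> \<exists>a b. w - (scale a u + scale b v) \<in> K"
    and indep: "\<And>a b. scale a u + scale b v \<in> K \<Longrightarrow> a = 0 \<and> b = 0"
  shows "H.fin_dim \<and> H.dim = 2 \<and> H.span {q u, q v} = carrier H"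
proof -
  \<comment> \<open>The coefficients 1 and -1 in the independence hypothesis separate the two
    classes. Hence the set has two elements, and a linear combination indexed by vectors has exactly
    two terms.\<close>
  have neq: "q u \<noteq> q v"
    using indep[of 1 "- 1"] q_eq_iff[OF assms(1,2)] by auto
  have sub: "{q u, q v} \<subseteq> carrier H"
    using assms q_closed by auto
  have lincomb: "H.lincomb a {q u, q v} = q (scale (a (q u)) u + scale (a (q v)) v)" for a
    unfolding H.lincomb_def using neq assms(1,2) q_closed
    by (simp add: q_add q_scale scale_S Pi_def)
  have gen_set: "H.span {q u, q v} = carrier H"
  proof
    show "H.span {q u, q v} \<subseteq> carrier H"
      by (rule H.span_is_subset2[OF sub])
    show "carrier H \<subseteq> H.span {q u, q v}"
    proof
      fix x assume "x \<in> carrier H"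
      then obtain w where w: "w \<in> S" "x = q w"
        using image by blast
      obtain a b where "w - (scale a u + scale b v) \<in> K"
        using gen w by blast
      then have "q w = q (scale a u + scale b v)"
        using q_eq_iff w assms by (simp add: add_S scale_S)
      then have "x = H.lincomb (\<lambda>y. if y = q u then a else b) {q u, q v}"
        using neq w by (simp add: lincomb)
      then show "x \<in> H.span {q u, q v}"
        by (auto simp: H.finite_span[OF _ sub])
    qed
  qed
  have "H.lin_indpt {q u, q v}"
  proof (rule H.finite_lin_indpt2[OF _ sub])
    fix a assume "H.lincomb a {q u, q v} = \<zero>\<^bsub>H\<^esub>"
    then have "scale (a (q u)) u + scale (a (q v)) v \<in> K"
      using assms by (intro kernelI) (simp_all add: lincomb add_S scale_S)
    then show "\<forall>x\<in>{q u, q v}. a x = \<zero>\<^bsub>scalars\<^esub>"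
      using indep by auto
  qed simp
  then have "H.basis {q u, q v}"
    using gen_set sub by (simp add: H.basis_def)
  then have "H.dim = 2"
    by (subst H.dim_basis[of "{q u, q v}"]) (simp_all add: neq)
  moreover have "H.fin_dim"
    unfolding H.fin_dim_def by (intro exI[of _ "{q u, q v}"] conjI gen_set sub) simp
  ultimately show ?thesis
    using gen_set by (intro conjI)
qed

end

section \<open>Homology of a complex of presented spaces\<close>

lemma cycles_presentation:
  assumes "presentation scale (C p) S K q" "presentation scale (C (p - 1)) S' K' q'"
    and "\<And>v. v \<in> S \<Longrightarrow> d p (q v) = q' (\<delta> v)" "\<And>v. v \<in> S \<Longrightarrow> \<delta> v \<in> S'"
    and lin: "\<And>v w. \<delta> (v + w) = \<delta> v + \<delta> w" "\<And>c v. \<delta> (scale c v) = scale c (\<delta> v)"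
  shows "presentation scale (cycles C d p) {v \<in> S. \<delta> v \<in> K'} K q"
proof -
  interpret P: presentation scale "C p" S K q by fact
  interpret P': presentation scale "C (p - 1)" S' K' q' by fact
  have dK: "d p (q v) = \<zero>\<^bsub>C (p - 1)\<^esub> \<longleftrightarrow> \<delta> v \<in> K'" if "v \<in> S" for v
    using assms(3,4)[OF that] P'.kernel by auto
  have \<delta>0: "\<delta> 0 = 0"
    using lin(1)[of 0 0] by simp
  \<comment> \<open>\<open>d p\<close> is merely a function on classes, but a vector of
    \<open>K\<close> has the same class as 0, so its image vanishes together with that of 0.\<close>
  have KS: "\<delta> v \<in> K'" if "v \<in> K" for v
    using P.kernelD[OF that] dK[of v] dK[of 0] \<delta>0 P'.zero_K P.zero_S P.q_zero by simp
  show ?thesis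
  proof
    show "q ` {v \<in> S. \<delta> v \<in> K'} = carrier (cycles C d p)"
      by (auto simp: cycles_def dK simp flip: P.image simp del: One_nat_def)
    show "{v \<in> {v \<in> S. \<delta> v \<in> K'}. q v = \<zero>\<^bsub>cycles C d p\<^esub>} = K"
      using KS P.kernel by (auto simp: cycles_def)
  qed (auto simp: P.zero_S \<delta>0 P'.zero_K P.add_S lin P'.add_K P.scale_S P'.scale_K P.q_add P.q_scale
      P.q_zero cycles_def)
qed

text \<open>The composite of two lifts is required to vanish only modulo \<open>K\<close>, as it
  should for a complex of quotients. The lemma is applied once with \<open>K\<close> zero, giving
  Koszul homology, and once with \<open>K\<close> the Koszul boundaries, giving higher Koszul
  homology.\<close>

lemma homology_presentation:
  assumes P: "\<And>p. presentation scale (C p) (S p) (K p) (q p)"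
    and d: "\<And>p v. v \<in> S p \<Longrightarrow> d p (q p v) = q (p - 1) (\<delta> p v)"
    and \<delta>_S: "\<And>p v. v \<in> S p \<Longrightarrow> \<delta> p v \<in> S (p - 1)"
    and lin: "\<And>p v w. \<delta> p (v + w) = \<delta> p v + \<delta> p w" "\<And>p c v. \<delta> p (scale c v) = scale c (\<delta> p v)"
    and square: "\<And>p v. v \<in> S (Suc p) \<Longrightarrow> \<delta> p (\<delta> (Suc p) v) \<in> K (p - 1)"
  shows "presentation scale (homology C d p) {v \<in> S p. \<delta> p v \<in> K (p - 1)}
    {k + \<delta> (Suc p) u | k u. k \<in> K p \<and> u \<in> S (Suc p)} (\<lambda>v. homology_class C d p (q p v))"
    (is "presentation _ _ ?Z ?B _")
proof -
  interpret P: presentation scale "C p" "S p" "K p" "q p" by (rule P)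
  interpret P1: presentation scale "C (Suc p)" "S (Suc p)" "K (Suc p)" "q (Suc p)" by (rule P)
  interpret Z: presentation scale "cycles C d p" ?Z "K p" "q p"
    by (rule cycles_presentation[where S' = "S (p - 1)" and q' = "q (p - 1)", OF P[of p] P[of "p - 1"]])
      (simp_all add: d \<delta>_S lin del: One_nat_def)
  have S1: "\<delta> (Suc p) u \<in> S p" if "u \<in> S (Suc p)" for u
    using \<delta>_S[OF that] by simp
  have BZ: "?B \<subseteq> ?Z"
    using Z.kernelD(1) S1 square Z.add_S by blast
  have \<delta>0: "\<delta> (Suc p) 0 = 0"
    using lin(1)[of "Suc p" 0 0] by simp
  have KB: "K p \<subseteq> ?B"
    using \<delta>0 P1.zero_S by force
  have qd: "q p (k + \<delta> (Suc p) u) = d (Suc p) (q (Suc p) u)" if "k \<in> K p" "u \<in> S (Suc p)" for k u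
    using that P.kernelD[OF that(1)] d[OF that(2)] S1[OF that(2)]
    by (simp add: P.q_add P.q_closed)
  have *: "boundaries C d p = q p ` ?B"
  proof
    show "boundaries C d p \<subseteq> q p ` ?B"
    proof
      fix x assume "x \<in> boundaries C d p"
      then obtain u where "u \<in> S (Suc p)" "x = d (Suc p) (q (Suc p) u)"
        unfolding boundaries_def P1.image[symmetric] by blast
      then show "x \<in> q p ` ?B"
        using qd[OF P.zero_K, of u] P.zero_K by (metis (mono_tags, lifting) image_eqI mem_Collect_eq)
    qed
    show "q p ` ?B \<subseteq> boundaries C d p"
      unfolding boundaries_def using qd P1.q_closed by auto
  qed
  have "presentation scale (mod_quot (cycles C d p) (q p ` ?B)) ?Z ?B
      (\<lambda>v. q p ` ?B +>\<^bsub>cycles C d p\<^esub> q p v)"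
  proof (rule Z.quotient[OF KB BZ])
    fix v w assume "v \<in> ?B" "w \<in> ?B"
    then obtain k u k' u' where "k \<in> K p" "u \<in> S (Suc p)" "v = k + \<delta> (Suc p) u"
        "k' \<in> K p" "u' \<in> S (Suc p)" "w = k' + \<delta> (Suc p) u'"
      by blast
    then have "v + w = (k + k') + \<delta> (Suc p) (u + u')" "k + k' \<in> K p" "u + u' \<in> S (Suc p)"
      by (simp_all add: lin P.add_K P1.add_S algebra_simps)
    then show "v + w \<in> ?B"
      by blast
  next
    fix c v assume "v \<in> ?B"
    then obtain k u where "k \<in> K p" "u \<in> S (Suc p)" "v = k + \<delta> (Suc p) u"
      by blast
    then have "scale c v = scale c k + \<delta> (Suc p) (scale c u)" "scale c k \<in> K p" "scale c u \<in> S (Suc p)"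
      by (simp_all add: lin P.scale_K P1.scale_S P.scale_right_distrib)
    then show "scale c v \<in> ?B"
      by blast
  qed
  \<comment> \<open>\<open>homology_class\<close> adds in \<open>C p\<close> while the quotient adds
    in the space of cycles; the two records differ only in their carriers.\<close>
  moreover have "q p ` ?B +>\<^bsub>cycles C d p\<^esub> x = homology_class C d p x" for x
    by (simp add: homology_class_def * a_r_coset_def' cycles_def)
  ultimately show ?thesis
    by (simp add: homology_def *)
qed

text \<open>The upper bounds for the spans defining \<open>rels\<close>, \<open>koszul_W\<close> and
  \<open>koszul_chains\<close> are all obtained this way, by exhibiting a subspace of the presenting
  space whose image contains the generators.\<close>

lemma (in presentation) span_subset:
  assumes "A \<subseteq> q ` L" "L \<subseteq> S" "0 \<in> L" "\<And>v w. v \<in> L \<Longrightarrow> w \<in> L \<Longrightarrow> v + w \<in> L"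
    "\<And>c v. v \<in> L \<Longrightarrow> scale c v \<in> L"
  shows "H.span A \<subseteq> q ` L"
proof (rule H.span_is_subset[OF assms(1)])
  show "LinearCombinations.submodule scalars (q ` L) H"
  proof
    fix v w assume "v \<in> q ` L" "w \<in> q ` L"
    then show "v \<oplus>\<^bsub>H\<^esub> w \<in> q ` L"
      using assms(2,4) by (auto simp: subset_iff simp flip: q_add)
  next
    fix c v assume "v \<in> q ` L"
    then show "c \<odot>\<^bsub>H\<^esub> v \<in> q ` L"
      using assms(2,5) by (auto simp: subset_iff simp flip: q_scale)
  next
    show "q ` L \<subseteq> carrier H"
      using assms(2) q_closed by blast
    show "\<zero>\<^bsub>H\<^esub> \<in> q ` L"
      using assms(3) q_zero by force
  qed
qed

section \<open>The tensor algebra\<close>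

definition tensor_scale :: "'k::field \<Rightarrow> ('x, 'k) tensor \<Rightarrow> ('x, 'k) tensor" where
  "tensor_scale c u = Poly_Mapping.single [] c * u"

lemma tensor_scale_single: "tensor_scale c (Poly_Mapping.single w a) = Poly_Mapping.single w (c * a)"
  by (simp add: tensor_scale_def mult_single plus_list_def)

lemma single_eq_tensor_scale: "Poly_Mapping.single w c = tensor_scale c (word w)"
  by (simp add: tensor_scale_single word_def)

lemma tensor_scale_mult_left: "tensor_scale c u * v = tensor_scale c (u * v)"
  by (simp add: tensor_scale_def mult.assoc)

lemma tensor_scale_add: "tensor_scale c (u + v) = tensor_scale c u + tensor_scale c v"
  by (simp add: tensor_scale_def distrib_left)

lemma tensor_induct [case_names zero word add scale]:
  assumes "P 0" "\<And>w. P (word w)" "\<And>u v. P u \<Longrightarrow> P v \<Longrightarrow> P (u + v)"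
    "\<And>c u. P u \<Longrightarrow> P (tensor_scale c u)"
  shows "P u"
proof (induction u rule: update_induct)
  case const
  show ?case by fact
next
  case (update u w c)
  have "Poly_Mapping.update w c u = u + Poly_Mapping.single w c"
    using update(1)
    by (intro poly_mapping_eqI) (auto simp: lookup_update lookup_add lookup_single in_keys_iff when_def)
  then show ?case
    using assms update by (simp add: single_eq_tensor_scale)
qed

text \<open>Scalars act as multiples of the empty word. Convolution over words is not commutative,
  so their centrality is checked on words and extended linearly.\<close>

lemma tensor_scale_mult_right: "u * tensor_scale c v = tensor_scale c (u * v)"
proof (induction u rule: tensor_induct)
  case (word w)
  have "Poly_Mapping.single w 1 * Poly_Mapping.single [] c = Poly_Mapping.single [] c * Poly_Mapping.single w 1"
    by (simp add: mult_single plus_list_def)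
  then show ?case
    by (simp add: tensor_scale_def word_def flip: mult.assoc)
next
  case (scale b u)
  then show ?case
    by (simp add: tensor_scale_mult_left)
      (simp add: tensor_scale_def mult_single plus_list_def mult.commute flip: mult.assoc)
qed (simp_all add: tensor_scale_add distrib_right, simp add: tensor_scale_def)

lemma lookup_tensor_scale [simp]:
  "Poly_Mapping.lookup (tensor_scale c u) w = c * Poly_Mapping.lookup u w"
  using mult_map_scale_conv_mult[of c u, symmetric]
  by (simp add: tensor_scale_def zero_list_def map.rep_eq when_def)

lemma vector_space_tensor_scale: "vector_space tensor_scale"
  by unfold_locales (auto intro!: poly_mapping_eqI simp: lookup_add algebra_simps)

interpretation tensor: vector_space tensor_scale
  by (rule vector_space_tensor_scale)

lemma tensor_algebra_simps [simp]:
  "carrier tensor_algebra = UNIV"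
  "u \<otimes>\<^bsub>tensor_algebra\<^esub> v = u * v"
  "u \<oplus>\<^bsub>tensor_algebra\<^esub> v = u + v"
  "\<zero>\<^bsub>tensor_algebra\<^esub> = 0"
  "\<one>\<^bsub>tensor_algebra\<^esub> = 1"
  "c \<odot>\<^bsub>tensor_algebra\<^esub> u = tensor_scale c u"
  by (simp_all add: tensor_algebra_def tensor_scale_def)

lemma presentation_tensor_algebra: "presentation tensor_scale tensor_algebra UNIV {0} id"
  using vector_space_tensor_scale
  by (auto simp: presentation_def presentation_axioms_def)

lemma ring_tensor_algebra: "Ring.ring (tensor_algebra :: ('k::field, ('x, 'k) tensor) module)"
proof (rule ringI)
  show "abelian_group (tensor_algebra :: ('k::field, ('x, 'k) tensor) module)"
    by (rule Module.module.axioms(2)[OF presentation.module_H[OF presentation_tensor_algebra]])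
  show "Group.monoid (tensor_algebra :: ('k::field, ('x, 'k) tensor) module)"
    by unfold_locales (auto simp: mult.assoc)
qed (auto simp: distrib_left distrib_right)

lemma word_mult: "word v * word w = word (v @ w)"
  by (simp add: word_def mult_single plus_list_def)

lemma word_Nil: "word [] = 1"
  using single_one by (simp add: word_def zero_list_def flip: single_one)

section \<open>Coordinates on the quadratic algebra\<close>

text \<open>Coordinates with respect to the basis \<open>1, x, y, xy, yx, xyx\<close> of the algebra. The relations
  imply \<open>yxy = 0\<close>, via \<open>yxy = y\<^sup>3 = xy\<^sup>2 = x\<^sup>2y\<close>.\<close>

type_synonym 'k six = "'k \<times> 'k \<times> 'k \<times> 'k \<times> 'k \<times> 'k"

definition six_scale :: "'k::field \<Rightarrow> 'k six \<Rightarrow> 'k six" where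
  "six_scale c = (\<lambda>(a1, ax, ay, axy, ayx, axyx). (c * a1, c * ax, c * ay, c * axy, c * ayx, c * axyx))"

text \<open>The entries come from reducing a letter times a basis word. On the left, y y = xy, y xy
  = 0 and y yx = xyx; on the right, both x y and y y give xy. That these tables describe the algebra
  is proved afterwards.\<close>

fun left :: "gen \<Rightarrow> 'k::field six \<Rightarrow> 'k six" where
  "left Gx (a1, ax, ay, axy, ayx, axyx) = (0, a1, 0, ay, 0, ayx)"
| "left Gy (a1, ax, ay, axy, ayx, axyx) = (0, 0, a1, ay, ax, ayx)"

fun right :: "gen \<Rightarrow> 'k::field six \<Rightarrow> 'k six" where
  "right Gx (a1, ax, ay, axy, ayx, axyx) = (0, a1, 0, 0, ay, axy)"
| "right Gy (a1, ax, ay, axy, ayx, axyx) = (0, 0, a1, ax + ay, 0, 0)"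

fun normal_form :: "gen list \<Rightarrow> 'k::field six" where
  "normal_form [] = (1, 0, 0, 0, 0, 0)"
| "normal_form (g # w) = left g (normal_form w)"

definition coord :: "(gen, 'k::field) tensor \<Rightarrow> 'k six" where
  "coord u = (\<Sum>w\<in>Poly_Mapping.keys u. six_scale (Poly_Mapping.lookup u w) (normal_form w))"

definition repr :: "'k::field six \<Rightarrow> (gen, 'k) tensor" where
  "repr = (\<lambda>(a1, ax, ay, axy, ayx, axyx).
    tensor_scale a1 (word []) + tensor_scale ax (word [Gx]) + tensor_scale ay (word [Gy])
    + tensor_scale axy (word [Gx, Gy]) + tensor_scale ayx (word [Gy, Gx])
    + tensor_scale axyx (word [Gx, Gy, Gx]))"

lemma vector_space_six_scale: "vector_space six_scale"
  by unfold_locales (auto simp: six_scale_def algebra_simps split: prod.splits)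

interpretation six: vector_space six_scale
  by (rule vector_space_six_scale)

lemma left_add: "left g (v + w) = left g v + left g w"
  by (cases "(g, v)" rule: left.cases; cases w) auto

lemma left_scale: "left g (six_scale c v) = six_scale c (left g v)"
  by (cases "(g, v)" rule: left.cases) (auto simp: six_scale_def)

lemma left_zero [simp]: "left g 0 = 0"
  by (cases g) (auto simp: zero_prod_def)

lemma right_add: "right g (v + w) = right g v + right g w"
  by (cases "(g, v)" rule: right.cases; cases w) (auto simp: algebra_simps)

lemma right_scale: "right g (six_scale c v) = six_scale c (right g v)"
  by (cases "(g, v)" rule: right.cases) (auto simp: six_scale_def algebra_simps)

lemma right_zero [simp]: "right g 0 = 0"
  by (cases g) (auto simp: zero_prod_def)

text \<open>The bimodule law, checked on the tables. It stands in for associativity before the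
  tables are tied to the algebra: \<open>normal_form\<close> recurses from the left, and this law
  makes appending a letter on the right computable.\<close>

lemma left_right: "left g (right h v) = right h (left g v)"
  by (cases g; cases h; cases v) auto

lemma normal_form_snoc: "normal_form (w @ [g]) = right g (normal_form w)"
proof (induction w)
  case Nil
  show ?case by (cases g) auto
qed (simp add: left_right)

lemma coord_add: "coord (u + v) = coord u + coord v"
  unfolding coord_def by (rule setsum_keys_plus_distrib) (auto simp: six.scale_left_distrib)

lemma coord_zero [simp]: "coord 0 = 0"
  by (simp add: coord_def)

lemma coord_word [simp]: "coord (word w) = normal_form w"
  by (simp add: coord_def word_def)

lemma coord_scale: "coord (tensor_scale c u) = six_scale c (coord u)"
proof (cases "c = 0")
  case True
  then show ?thesis by simp
next
  case False
  have "Poly_Mapping.keys (tensor_scale c u) = Poly_Mapping.keys u"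
    using False by (auto simp: in_keys_iff)
  then show ?thesis
    by (simp add: coord_def six.scale_sum_right)
qed

lemma coord_word_Cons: "coord (word [g] * u) = left g (coord u)"
  by (induction u rule: tensor_induct)
    (simp_all add: word_mult coord_add left_add distrib_left tensor_scale_mult_right coord_scale left_scale)

lemma coord_mult_gen: "coord (u * word [g]) = right g (coord u)"
  by (induction u rule: tensor_induct)
    (simp_all add: word_mult coord_add right_add distrib_right tensor_scale_mult_left coord_scale
      right_scale normal_form_snoc)

text \<open>Peeling letters off \<open>u\<close> turns the product into iterated
  \<open>left g\<close>, which fixes 0. So the kernel of \<open>coord\<close> is a left
  ideal.\<close>

lemma coord_mult_zero: "coord v = 0 \<Longrightarrow> coord (u * v) = 0"
proof (induction u rule: tensor_induct)
  case (word w)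
  then show ?case
  proof (induction w)
    case (Cons g w)
    have "word (g # w) * v = word [g] * (word w * v)"
      by (simp add: word_mult flip: mult.assoc)
    with Cons show ?case
      by (simp add: coord_word_Cons)
  qed (simp add: word_Nil)
next
  case (scale c u)
  from scale show ?case
    by (simp add: tensor_scale_mult_left coord_scale)
qed (simp_all add: distrib_right coord_add)

lemma repr_add: "repr (v + w) = repr v + repr w"
  by (cases v; cases w) (simp add: repr_def tensor.scale_left_distrib algebra_simps)

lemma repr_scale: "repr (six_scale c v) = tensor_scale c (repr v)"
  by (cases v) (simp add: repr_def six_scale_def tensor.scale_right_distrib)

lemma repr_zero [simp]: "repr 0 = 0"
  using repr_add[of 0 0] by simp

lemma coord_repr [simp]: "coord (repr v) = v"
  by (cases v) (simp add: repr_def coord_add coord_scale, simp add: six_scale_def)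

section \<open>The ideal of relations as the kernel of the coordinate map\<close>

abbreviation rel_ideal :: "(gen, 'k::field) tensor set" where
  "rel_ideal \<equiv> Idl\<^bsub>tensor_algebra\<^esub> rels"

lemma rels_gens:
  "word [Gx, Gx] \<in> (rels :: (gen, 'k::field) tensor set)"
  "word [Gy, Gy] - word [Gx, Gy] \<in> (rels :: (gen, 'k) tensor set)"
proof -
  interpret T: presentation tensor_scale "tensor_algebra :: ('k, (gen, 'k) tensor) module" UNIV "{0}" id
    by (rule presentation_tensor_algebra)
  show "word [Gx, Gx] \<in> (rels :: (gen, 'k) tensor set)"
    "word [Gy, Gy] - word [Gx, Gy] \<in> (rels :: (gen, 'k) tensor set)"
    unfolding rels_def by (auto intro!: subsetD[OF T.H.in_own_span])
qed

lemma rels_subset: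
  assumes "word [Gx, Gx] \<in> L" "word [Gy, Gy] - word [Gx, Gy] \<in> L"
    "0 \<in> L" "\<And>v w. v \<in> L \<Longrightarrow> w \<in> L \<Longrightarrow> v + w \<in> L" "\<And>c v. v \<in> L \<Longrightarrow> tensor_scale c v \<in> L"
  shows "rels \<subseteq> L"
  using presentation.span_subset[OF presentation_tensor_algebra, of _ L] assms
  unfolding rels_def by auto

lemma ideal_rel_ideal: "ideal rel_ideal (tensor_algebra :: ('k::field, (gen, 'k) tensor) module)"
  by (rule ring.genideal_ideal[OF ring_tensor_algebra]) simp

lemma rel_ideal_closed:
  fixes u v :: "(gen, 'k::field) tensor"
  shows "(0 :: (gen, 'k) tensor) \<in> rel_ideal"
    "u \<in> rel_ideal \<Longrightarrow> v \<in> rel_ideal \<Longrightarrow> u + v \<in> rel_ideal"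
    "u \<in> rel_ideal \<Longrightarrow> v * u \<in> rel_ideal"
    "u \<in> rel_ideal \<Longrightarrow> u * v \<in> rel_ideal"
    "u \<in> rel_ideal \<Longrightarrow> tensor_scale c u \<in> rel_ideal"
proof -
  interpret ideal rel_ideal "tensor_algebra :: ('k, (gen, 'k) tensor) module"
    by (rule ideal_rel_ideal)
  show "(0 :: (gen, 'k) tensor) \<in> rel_ideal"
    using additive_subgroup.zero_closed[OF is_additive_subgroup] by simp
  show "u \<in> rel_ideal \<Longrightarrow> v \<in> rel_ideal \<Longrightarrow> u + v \<in> rel_ideal"
    using additive_subgroup.a_closed[OF is_additive_subgroup] by simp
  show "u \<in> rel_ideal \<Longrightarrow> v * u \<in> rel_ideal"
    using I_l_closed by simp
  show "u \<in> rel_ideal \<Longrightarrow> u * v \<in> rel_ideal"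
    using I_r_closed by simp
  show "u \<in> rel_ideal \<Longrightarrow> tensor_scale c u \<in> rel_ideal"
    unfolding tensor_scale_def using I_l_closed by simp
qed

lemma rels_rel_ideal: "rels \<subseteq> rel_ideal"
  by (rule ring.genideal_self[OF ring_tensor_algebra]) simp

lemma rel_ideal_minus: "u \<in> rel_ideal \<Longrightarrow> - u \<in> rel_ideal"
  using rel_ideal_closed(3)[of u "- 1"] by simp

text \<open>\<open>J\<close> below is the annihilator of the six-dimensional left module defined by \<^const>\<open>left\<close>.\<close>

lemma coord_rel_ideal: "u \<in> rel_ideal \<Longrightarrow> coord u = 0"
proof -
  define J where "J = {u :: (gen, 'a) tensor. \<forall>v. coord (u * v) = 0}"
  have "rels \<subseteq> J"
  proof (rule rels_subset)
    have *: "word [g, h] * v = word [g] * (word [h] * v)" for g h and v :: "(gen, 'a) tensor"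
      by (simp add: word_mult flip: mult.assoc)
    have "left Gx (left Gx a) = 0" for a :: "'a six"
      by (cases a) (simp add: zero_prod_def)
    then show "word [Gx, Gx] \<in> J"
      by (simp add: J_def * coord_word_Cons)
    have "left Gy (left Gy a) = left Gx (left Gy a)" for a :: "'a six"
      by (cases a) simp
    then have "coord (word [Gy, Gy] * v) = coord (word [Gx, Gy] * v)" for v :: "(gen, 'a) tensor"
      by (simp add: * coord_word_Cons)
    then have "coord ((word [Gy, Gy] - word [Gx, Gy]) * v) = 0" for v :: "(gen, 'a) tensor"
      using coord_add[of "(word [Gy, Gy] - word [Gx, Gy]) * v" "word [Gx, Gy] * v"]
      by (simp add: left_diff_distrib)
    then show "word [Gy, Gy] - word [Gx, Gy] \<in> J"
      by (simp add: J_def)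
  qed (auto simp: J_def distrib_right coord_add tensor_scale_mult_left coord_scale)
  moreover have "ideal J tensor_algebra"
  proof (rule idealI[OF ring_tensor_algebra])
    have "- u \<in> J" if "u \<in> J" for u
      using that coord_add[of "u * v" "- u * v" for v] by (simp add: J_def)
    moreover have "\<ominus>\<^bsub>tensor_algebra\<^esub> u = - u" for u :: "(gen, 'a) tensor"
      using abelian_group.minus_equality[OF ring.is_abelian_group[OF ring_tensor_algebra], of "- u" u]
      by simp
    ultimately have "inv\<^bsub>add_monoid tensor_algebra\<^esub> u \<in> J" if "u \<in> J" for u
      using that by (simp only: a_inv_def)
    then show "subgroup J (add_monoid tensor_algebra)"
      by (intro subgroup.intro) (auto simp: J_def distrib_right coord_add)
  qed (auto simp: J_def mult.assoc coord_mult_zero)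
  ultimately have "rel_ideal \<subseteq> J"
    by (intro ring.genideal_minimal[OF ring_tensor_algebra])
  then show "coord u = 0" if "u \<in> rel_ideal" for u :: "(gen, 'a) tensor"
    using that by (auto simp: J_def dest!: spec[of _ 1] subsetD)
qed

definition alg_of :: "'k::field six \<Rightarrow> (gen, 'k) tensor set" where
  "alg_of v = alg_class rels (repr v)"

text \<open>One rewriting step modulo the ideal. The difference is written out as a combination of
  multiples of xx, yy - xy and yxy.\<close>

lemma rel_ideal_gen_repr: "word [g] * repr v - repr (left g v) \<in> rel_ideal"
proof -
  let ?r = "word [Gy, Gy] - word [Gx, Gy] :: (gen, 'a) tensor"
  note closed = rel_ideal_closed(2-5)
  have xx: "word [Gx, Gx] \<in> (rel_ideal :: (gen, 'a) tensor set)" and r: "?r \<in> rel_ideal"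
    using rels_gens rels_rel_ideal by blast+
  have xxw: "word (Gx # Gx # w) \<in> (rel_ideal :: (gen, 'a) tensor set)" for w
    using closed(3)[OF xx, of "word w"] by (simp add: word_mult)
  have rw: "word (Gy # Gy # w) - word (Gx # Gy # w) \<in> (rel_ideal :: (gen, 'a) tensor set)" for w
    using closed(3)[OF r, of "word w"] by (simp add: word_mult left_diff_distrib)
  \<comment> \<open>The overlap yyy is reduced through its first and through its last two letters.
    All other words cancel in this combination and yxy is left.\<close>
  have "?r * word [Gy] + word [Gx] * ?r + word [Gx, Gx] * word [Gy] - word [Gy] * ?r \<in> rel_ideal"
    using closed(1)[OF _ rel_ideal_minus] closed(1-3) xx r by (metis diff_conv_add_uminus)
  then have yxy: "word [Gy, Gx, Gy] \<in> (rel_ideal :: (gen, 'a) tensor set)"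
    by (simp add: word_mult left_diff_distrib right_diff_distrib)
  have yxyw: "word (Gy # Gx # Gy # w) \<in> (rel_ideal :: (gen, 'a) tensor set)" for w
    using closed(3)[OF yxy, of "word w"] by (simp add: word_mult)
  obtain a1 ax ay axy ayx axyx where v: "v = (a1, ax, ay, axy, ayx, axyx)"
    by (cases v)
  show ?thesis
  proof (cases g)
    case Gx
    have "word [g] * repr v - repr (left g v) = tensor_scale ax (word [Gx, Gx])
        + tensor_scale axy (word [Gx, Gx, Gy]) + tensor_scale axyx (word [Gx, Gx, Gy, Gx])"
      by (simp add: v Gx repr_def distrib_left tensor_scale_mult_right word_mult)
    then show ?thesis
      by (simp add: closed(1,4) xxw)
  next
    case Gy
    have "word [g] * repr v - repr (left g v) = tensor_scale ay (word [Gy, Gy] - word [Gx, Gy])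
        + tensor_scale axy (word [Gy, Gx, Gy])
        + tensor_scale ayx (word [Gy, Gy, Gx] - word [Gx, Gy, Gx])
        + tensor_scale axyx (word [Gy, Gx, Gy, Gx])"
      by (simp add: v Gy repr_def distrib_left tensor_scale_mult_right word_mult tensor.scale_right_diff_distrib)
    then show ?thesis
      by (simp add: closed(1,4) rw yxyw)
  qed
qed

text \<open>The spanning half of the basis statement, by prefixing one letter at a time. Its
  counterpart \<open>coord_rel_ideal\<close> gives the independence of the six basis words.\<close>

lemma rel_ideal_repr_coord: "u - repr (coord u) \<in> rel_ideal"
  for u :: "(gen, 'k::field) tensor"
proof (induction u rule: tensor_induct)
  case zero
  show ?case by (simp add: rel_ideal_closed)
next
  case (word w)
  show ?case
  proof (induction w)
    case Nil
    show ?case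
      by (simp add: repr_def rel_ideal_closed(1))
  next
    case (Cons g w)
    have "word (g # w) - repr (coord (word (g # w)))
        = word [g] * (word w - repr (coord (word w)))
          + (word [g] * repr (normal_form w) - repr (left g (normal_form w)))"
      by (simp add: right_diff_distrib word_mult)
    then show ?case
      using rel_ideal_closed(2)[OF rel_ideal_closed(3)[OF Cons] rel_ideal_gen_repr] by metis
  qed
next
  case (add u v)
  from rel_ideal_closed(2)[OF this] show ?case
    by (simp add: coord_add repr_add algebra_simps)
next
  case (scale c u)
  from rel_ideal_closed(5)[OF scale, of c] show ?case
    by (simp add: coord_scale repr_scale tensor.scale_right_diff_distrib)
qed

lemma rel_ideal_eq: "u \<in> rel_ideal \<longleftrightarrow> coord u = 0"
  using coord_rel_ideal[of u] rel_ideal_repr_coord[of u] by auto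

lemma presentation_quadratic_tensor:
  "presentation tensor_scale (quadratic_algebra rels) UNIV rel_ideal
    (alg_class rels :: (gen, 'k::field) tensor \<Rightarrow> _)"
proof -
  interpret T: presentation tensor_scale "tensor_algebra :: ('k, (gen, 'k) tensor) module" UNIV "{0}" id
    by (rule presentation_tensor_algebra)
  have "presentation tensor_scale
      (mod_quot (tensor_algebra :: ('k, (gen, 'k) tensor) module) (id ` rel_ideal))
      UNIV rel_ideal (\<lambda>u. id ` rel_ideal +>\<^bsub>tensor_algebra\<^esub> id u)"
    by (rule T.quotient) (auto intro: rel_ideal_closed)
  then show ?thesis
    by (simp add: quadratic_algebra_def alg_class_def[abs_def])
qed

lemma alg_class_eq: "alg_of (coord u) = alg_class rels u"
proof -
  interpret Q: presentation tensor_scale "quadratic_algebra rels :: ('a, (gen, 'a) tensor set) module"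
      UNIV rel_ideal "alg_class rels"
    by (rule presentation_quadratic_tensor)
  show ?thesis
    using Q.q_eq_iff[of u "repr (coord u)"] rel_ideal_repr_coord[of u] by (auto simp: alg_of_def)
qed

lemma presentation_quadratic:
  "presentation six_scale (quadratic_algebra rels) UNIV {0} (alg_of :: 'k::field six \<Rightarrow> _)"
proof -
  interpret Q: presentation tensor_scale "quadratic_algebra rels :: ('k, (gen, 'k) tensor set) module"
      UNIV rel_ideal "alg_class rels"
    by (rule presentation_quadratic_tensor)
  \<comment> \<open>Every class already contains a normal form, so restricting to the range of
    \<open>repr\<close> loses none.\<close>
  have "alg_class rels ` range repr = carrier (quadratic_algebra rels :: ('k, (gen, 'k) tensor set) module)"
    unfolding Q.image[symmetric] using alg_class_eq[where 'a = 'k] by (force simp: image_image alg_of_def)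
  then show ?thesis
    unfolding alg_of_def[abs_def] by (intro Q.reparam vector_space_six_scale)
      (auto simp: repr_add repr_scale rel_ideal_eq)
qed

lemma alg_class_mult:
  "alg_class rels u \<otimes>\<^bsub>quadratic_algebra rels\<^esub> alg_class rels v = alg_class rels (u * v)"
  using ideal.rcoset_mult_add[OF ideal_rel_ideal, of u v]
  by (simp add: quadratic_algebra_def mod_quot_def alg_class_def)

lemma alg_class_mult_gen:
  "alg_of v \<otimes>\<^bsub>quadratic_algebra rels\<^esub> alg_class rels (word [g])
    = alg_of (right g v)"
  "alg_class rels (word [g]) \<otimes>\<^bsub>quadratic_algebra rels\<^esub> alg_of v
    = alg_of (left g v)"
  using alg_class_eq[of "repr v * word [g]"] alg_class_eq[of "word [g] * repr v"]
  by (simp_all add: alg_of_def alg_class_mult coord_mult_gen coord_word_Cons)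

lemma (in presentation) subobject:
  assumes "S' \<subseteq> S" "0 \<in> S'" "\<And>v w. v \<in> S' \<Longrightarrow> w \<in> S' \<Longrightarrow> v + w \<in> S'"
    "\<And>c v. v \<in> S' \<Longrightarrow> scale c v \<in> S'"
  shows "presentation scale (H\<lparr>carrier := q ` S'\<rparr>) S' (K \<inter> S') q"
  by unfold_locales (use assms kernel in \<open>auto simp: q_add q_scale q_zero subset_iff\<close>)

section \<open>Chains with coefficients in the tensor powers\<close>

type_synonym 'k model_chain = "gen list \<Rightarrow> 'k six"

definition chain_scale :: "'k::field \<Rightarrow> 'k model_chain \<Rightarrow> 'k model_chain" where
  "chain_scale c F = (\<lambda>w. six_scale c (F w))"

definition chain_of :: "'k::field model_chain \<Rightarrow> gen list \<Rightarrow> (gen, 'k) tensor set" where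
  "chain_of F = (\<lambda>w. alg_of (F w))"

lemma vector_space_chain_scale: "vector_space chain_scale"
  by unfold_locales (auto simp: chain_scale_def fun_eq_iff six.scale_right_distrib six.scale_left_distrib)

lemma presentation_tensor_chains:
  "presentation chain_scale (tensor_chains rels p) {F. \<forall>w. length w \<noteq> p \<longrightarrow> F w = 0} {0}
    (chain_of :: 'k::field model_chain \<Rightarrow> _)"
proof -
  interpret V: vector_space "chain_scale :: 'k \<Rightarrow> _" by (rule vector_space_chain_scale)
  interpret Q: presentation six_scale "quadratic_algebra rels :: ('k, (gen, 'k) tensor set) module"
      UNIV "{0}" alg_of
    by (rule presentation_quadratic)
  have Q_zero: "alg_of v = \<zero>\<^bsub>quadratic_algebra rels\<^esub> \<longleftrightarrow> v = 0" for v :: "'k six"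
    using Q.kernel by auto
  show ?thesis
  proof
    show "chain_of ` {F. \<forall>w. length w \<noteq> p \<longrightarrow> F w = 0}
        = carrier (tensor_chains rels p :: ('k, gen list \<Rightarrow> (gen, 'k) tensor set) module)"
    proof
      show "chain_of ` {F. \<forall>w. length w \<noteq> p \<longrightarrow> F w = 0}
          \<subseteq> carrier (tensor_chains rels p :: ('k, gen list \<Rightarrow> (gen, 'k) tensor set) module)"
        by (auto simp: tensor_chains_def chain_of_def Q.q_closed Q.q_zero)
      show "carrier (tensor_chains rels p :: ('k, gen list \<Rightarrow> (gen, 'k) tensor set) module)
          \<subseteq> chain_of ` {F. \<forall>w. length w \<noteq> p \<longrightarrow> F w = 0}"
      proof
        fix f assume f: "f \<in> carrier (tensor_chains rels p :: ('k, gen list \<Rightarrow> (gen, 'k) tensor set) module)"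
        define F where "F w = inv_into UNIV alg_of (f w)" for w
        have "f w \<in> range alg_of" for w
          using f by (simp add: tensor_chains_def Q.image)
        then have F: "f w = alg_of (F w)" for w
          unfolding F_def by (simp only: f_inv_into_f)
        then have "\<forall>w. length w \<noteq> p \<longrightarrow> F w = 0"
          using f by (auto simp: tensor_chains_def Q_zero)
        then show "f \<in> chain_of ` {F. \<forall>w. length w \<noteq> p \<longrightarrow> F w = 0}"
          using F by (force simp: chain_of_def)
      qed
    qed
    show "{F \<in> {F. \<forall>w. length w \<noteq> p \<longrightarrow> F w = 0}.
        chain_of F = \<zero>\<^bsub>tensor_chains rels p :: ('k, gen list \<Rightarrow> (gen, 'k) tensor set) module\<^esub>} = {0}"
      by (auto simp: tensor_chains_def chain_of_def Q_zero fun_eq_iff)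
  qed (auto simp: chain_scale_def tensor_chains_def chain_of_def Q.q_add Q.q_scale Q.q_zero)
qed

lemma pure_tensor_chain_of:
  "pure_tensor rels (alg_of a) u = chain_of (\<lambda>w. six_scale (Poly_Mapping.lookup u w) a)"
proof -
  interpret Q: presentation six_scale "quadratic_algebra rels :: ('a, (gen, 'a) tensor set) module"
      UNIV "{0}" alg_of
    by (rule presentation_quadratic)
  show ?thesis
    by (simp add: pure_tensor_def chain_of_def Q.q_scale)
qed

definition cap_model :: "nat \<Rightarrow> 'k::field model_chain \<Rightarrow> 'k model_chain" where
  "cap_model p F = (\<lambda>u. six_scale ((- 1) ^ (p - 1)) (left Gx (F (u @ [Gx])) + left Gy (F (u @ [Gy]))))"

definition right_model :: "'k::field model_chain \<Rightarrow> 'k model_chain" where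
  "right_model F = (\<lambda>u. right Gx (F (Gx # u)) + right Gy (F (Gy # u)))"

lemma finite_words: "finite {w :: gen list. length w = p}"
  using finite_lists_length_eq[of "UNIV :: gen set" p] by simp

lemma words_tl:
  "{w. length w = Suc n} \<inter> {w. tl w = u} = (if length u = n then {Gx # u, Gy # u} else {})"
proof -
  have "length w = Suc n \<and> tl w = u \<longleftrightarrow> length u = n \<and> (w = Gx # u \<or> w = Gy # u)" for w
    by (cases w; cases "hd w") auto
  then show ?thesis
    unfolding set_eq_iff Int_iff mem_Collect_eq by (simp only: insert_iff empty_iff split: if_split) blast
qed

lemma sum_words_tl:
  "(\<Sum>w | length w = Suc n. if tl w = u then G w else 0)
    = (if length u = n then G (Gx # u) + G (Gy # u) else (0 :: 'a::comm_monoid_add))"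
proof -
  have "(\<Sum>w | length w = Suc n. if tl w = u then G w else 0)
      = sum G ({w. length w = Suc n} \<inter> {w. tl w = u})"
    using finite_words by (simp add: sum.inter_restrict)
  then show ?thesis
    by (simp add: words_tl)
qed

lemma words_butlast:
  "{w. length w = Suc n} \<inter> {w. butlast w = u} = (if length u = n then {u @ [Gx], u @ [Gy]} else {})"
proof -
  have "length w = Suc n \<and> butlast w = u \<longleftrightarrow> length u = n \<and> (w = u @ [Gx] \<or> w = u @ [Gy])" for w
    by (cases w rule: rev_cases; cases "last w") auto
  then show ?thesis
    unfolding set_eq_iff Int_iff mem_Collect_eq by (simp only: insert_iff empty_iff split: if_split) blast
qed

lemma sum_words_butlast:
  "(\<Sum>w | length w = Suc n. if butlast w = u then G w else 0)
    = (if length u = n then G (u @ [Gx]) + G (u @ [Gy]) else (0 :: 'a::comm_monoid_add))"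
proof -
  have "(\<Sum>w | length w = Suc n. if butlast w = u then G w else 0)
      = sum G ({w. length w = Suc n} \<inter> {w. butlast w = u})"
    using finite_words by (simp add: sum.inter_restrict)
  then show ?thesis
    by (simp add: words_butlast)
qed

lemma lookup_word_scale: "six_scale (Poly_Mapping.lookup (word v) w) a = (if v = w then a else 0)"
  by (simp add: word_def lookup_single when_def)

lemma sum_fun_apply: "(\<Sum>i\<in>I. F i) u = (\<Sum>i\<in>I. F i u)"
  by (induction I rule: infinite_finite_induct) auto

text \<open>The summand of a word w is the image of a coordinate function \<open>G w\<close>
  supported at \<open>butlast w\<close>. Once the sum is moved to these functions, its value at u
  involves only the words ux and uy.\<close>

lemma koszul_cap_chain_of:
  fixes F :: "'k::field model_chain"
  assumes "p > 0" "\<And>w. length w \<noteq> p \<Longrightarrow> F w = 0"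
  shows "koszul_cap rels p (chain_of F) = chain_of (cap_model p F)"
proof -
  obtain n where p: "p = Suc n" using assms(1) by (cases p) auto
  interpret C: presentation chain_scale "tensor_chains rels n :: ('k, gen list \<Rightarrow> (gen, 'k) tensor set) module"
      "{F. \<forall>w. length w \<noteq> n \<longrightarrow> F w = 0}" "{0}" chain_of
    by (rule presentation_tensor_chains)
  define G where "G w = (\<lambda>u. if butlast w = u then six_scale ((- 1) ^ n) (left (last w) (F w)) else 0)" for w
  have G: "G w \<in> {F. \<forall>w. length w \<noteq> n \<longrightarrow> F w = 0}" if "length w = p" for w
    using that by (auto simp: G_def p)
  have "(- 1) ^ n \<odot>\<^bsub>tensor_chains rels n\<^esub>
         pure_tensor rels (alg_class rels (word [last w]) \<otimes>\<^bsub>quadratic_algebra rels\<^esub> chain_of F w) (word (butlast w))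
      = chain_of (G w)" (is "?l = _") if "length w = p" for w
  proof -
    have "?l = chain_of (chain_scale ((- 1) ^ n) (\<lambda>u. if butlast w = u then left (last w) (F w) else 0))"
      using that by (subst C.q_scale)
        (auto simp: chain_of_def[of F] alg_class_mult_gen pure_tensor_chain_of lookup_word_scale p)
    also have "chain_scale ((- 1) ^ n) (\<lambda>u. if butlast w = u then left (last w) (F w) else 0) = G w"
      by (auto simp: chain_scale_def G_def)
    finally show ?thesis .
  qed
  then have "koszul_cap rels p (chain_of F) = finsum (tensor_chains rels n) (\<lambda>w. chain_of (G w)) {w. length w = p}"
    unfolding koszul_cap_def using G C.q_closed by (auto simp: p intro!: C.H.finsum_cong')
  also have "\<dots> = chain_of (\<Sum>w | length w = p. G w)"
    using C.q_finsum[OF finite_words, of p G] G by blast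
  also have "(\<Sum>w | length w = p. G w) = cap_model p F"
  proof
    fix u
    have "(\<Sum>w | length w = p. G w) u
        = (if length u = n then six_scale ((- 1) ^ n) (left Gx (F (u @ [Gx]))) + six_scale ((- 1) ^ n) (left Gy (F (u @ [Gy]))) else 0)"
      unfolding sum_fun_apply G_def p by (subst sum_words_butlast) simp
    \<comment> \<open>\<open>cap_model\<close> has no case distinction on the length of u: for a
      wrong length, \<open>F\<close> vanishes at both extended words.\<close>
    then show "(\<Sum>w | length w = p. G w) u = cap_model p F u"
      using assms(2) by (simp add: cap_model_def p six.scale_right_distrib)
  qed
  finally show ?thesis .
qed

text \<open>Since (-1)^p = -(-1)^(p-1), the second half of the Koszul differential is minus the cap
  product.\<close>

lemma koszul_b_chain_of:
  fixes F :: "'k::field model_chain"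
  assumes "p > 0" "\<And>w. length w \<noteq> p \<Longrightarrow> F w = 0"
  shows "koszul_b rels p (chain_of F) = chain_of (right_model F - cap_model p F)"
proof -
  obtain n where p: "p = Suc n" using assms(1) by (cases p) auto
  interpret C: presentation chain_scale "tensor_chains rels n :: ('k, gen list \<Rightarrow> (gen, 'k) tensor set) module"
      "{F. \<forall>w. length w \<noteq> n \<longrightarrow> F w = 0}" "{0}" chain_of
    by (rule presentation_tensor_chains)
  define G where "G w = (\<lambda>u. if butlast w = u then six_scale ((- 1) ^ p) (left (last w) (F w)) else 0)" for w
  define G' where "G' w = (\<lambda>u. if tl w = u then right (hd w) (F w) else 0)" for w
  have G: "G w \<in> {F. \<forall>w. length w \<noteq> n \<longrightarrow> F w = 0}" if "length w = p" for w
    using that by (auto simp: G_def p)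
  have G': "G' w \<in> {F. \<forall>w. length w \<noteq> n \<longrightarrow> F w = 0}" if "length w = p" for w
    using that by (auto simp: G'_def p)
  have G1: "(- 1) ^ p \<odot>\<^bsub>tensor_chains rels n\<^esub>
         pure_tensor rels (alg_class rels (word [last w]) \<otimes>\<^bsub>quadratic_algebra rels\<^esub> chain_of F w) (word (butlast w))
      = chain_of (G w)" (is "?l = _") if "length w = p" for w
  proof -
    have "?l = chain_of (chain_scale ((- 1) ^ p) (\<lambda>u. if butlast w = u then left (last w) (F w) else 0))"
      using that by (subst C.q_scale)
        (auto simp: chain_of_def[of F] alg_class_mult_gen pure_tensor_chain_of lookup_word_scale p)
    also have "chain_scale ((- 1) ^ p) (\<lambda>u. if butlast w = u then left (last w) (F w) else 0) = G w"
      by (auto simp: chain_scale_def G_def)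
    finally show ?thesis .
  qed
  have G2: "pure_tensor rels (chain_of F w \<otimes>\<^bsub>quadratic_algebra rels\<^esub> alg_class rels (word [hd w])) (word (tl w))
      = chain_of (G' w)" for w
    by (simp add: chain_of_def[of F] alg_class_mult_gen pure_tensor_chain_of lookup_word_scale G'_def)
  have "koszul_b rels p (chain_of F) = finsum (tensor_chains rels n) (\<lambda>w. chain_of (G' w + G w)) {w. length w = p}"
    unfolding koszul_b_def using assms(1)
  proof (simp only: less_imp_neq[THEN not_sym] if_False diff_Suc_1 p, intro C.H.finsum_cong'[OF refl])
    show "(\<lambda>w. chain_of (G' w + G w)) \<in> {w. length w = Suc n} \<rightarrow> carrier (tensor_chains rels n)"
      using C.q_closed[OF C.add_S[OF G' G]] by (auto simp: p)
  next
    fix w assume "w \<in> {w :: gen list. length w = Suc n}"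
    then have w: "length w = p"
      by (simp add: p)
    show "pure_tensor rels (chain_of F w \<otimes>\<^bsub>quadratic_algebra rels\<^esub> alg_class rels (word [hd w])) (word (tl w))
        \<oplus>\<^bsub>tensor_chains rels n\<^esub> (- 1) ^ Suc n \<odot>\<^bsub>tensor_chains rels n\<^esub>
          pure_tensor rels (alg_class rels (word [last w]) \<otimes>\<^bsub>quadratic_algebra rels\<^esub> chain_of F w) (word (butlast w))
        = chain_of (G' w + G w)"
      unfolding G2 G1[OF w, unfolded p] by (rule C.q_add[OF G'[OF w] G[OF w], symmetric])
  qed
  also have "\<dots> = chain_of (\<Sum>w | length w = p. G' w + G w)"
    using C.q_finsum[OF finite_words, of p "\<lambda>w. G' w + G w"] C.add_S[OF G' G] by blast
  also have "(\<Sum>w | length w = p. G' w + G w) = right_model F - cap_model p F"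
  proof
    fix u
    have "(\<Sum>w | length w = p. G' w + G w) u
        = (if length u = n then right Gx (F (Gx # u)) + right Gy (F (Gy # u)) else 0)
          + (if length u = n then six_scale ((- 1) ^ p) (left Gx (F (u @ [Gx]))) + six_scale ((- 1) ^ p) (left Gy (F (u @ [Gy]))) else 0)"
      unfolding sum_fun_apply plus_fun_apply sum.distrib
      unfolding G_def G'_def p sum_words_tl sum_words_butlast by simp
    then show "(\<Sum>w | length w = p. G' w + G w) u = (right_model F - cap_model p F) u"
      using assms(2) by (simp add: cap_model_def right_model_def p six.scale_right_distrib)
  qed
  finally show ?thesis .
qed

section \<open>The spaces $W_p$ and the Koszul chains\<close>

lemma tensor_power_induct [consumes 1, case_names zero word add scale]:
  assumes "u \<in> tensor_power n" "P 0" "\<And>w. length w = n \<Longrightarrow> P (word w)"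
    "\<And>u v. P u \<Longrightarrow> P v \<Longrightarrow> P (u + v)" "\<And>c u. P u \<Longrightarrow> P (tensor_scale c u)"
  shows "P u"
  using assms(1)
proof (induction u rule: update_induct)
  case const
  show ?case by fact
next
  case (update u w c)
  have "Poly_Mapping.update w c u = u + Poly_Mapping.single w c"
    using update(1)
    by (intro poly_mapping_eqI) (auto simp: lookup_update lookup_add lookup_single in_keys_iff when_def)
  moreover have "length w = n" "u \<in> tensor_power n"
    using update(2,4) by (auto simp: tensor_power_def keys_update)
  ultimately show ?case
    using assms(3,4,5) update(3) by (simp add: single_eq_tensor_scale)
qed

lemma lookup_word: "Poly_Mapping.lookup (word v) w = (if v = w then 1 else 0)"
  by (simp add: word_def lookup_single when_def)

text \<open>Equations for the tensors with a relation at a fixed position. Inside V \<otimes> V, the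
  space R is the common kernel of two functionals, the coefficient of yx and the sum of the
  coefficients of xy and yy. Equations, unlike spans, can simply be collected when spaces are
  intersected.\<close>

definition rel_at :: "nat \<Rightarrow> nat \<Rightarrow> (gen, 'k::field) tensor set" where
  "rel_at i j = {u. (\<forall>w. length w \<noteq> i + 2 + j \<longrightarrow> Poly_Mapping.lookup u w = 0) \<and>
    (\<forall>a b. length a = i \<longrightarrow> length b = j \<longrightarrow>
      Poly_Mapping.lookup u (a @ [Gy, Gx] @ b) = 0 \<and>
      Poly_Mapping.lookup u (a @ [Gx, Gy] @ b) = - Poly_Mapping.lookup u (a @ [Gy, Gy] @ b))}"

lemma rel_at_closed:
  "0 \<in> rel_at i j"
  "u \<in> rel_at i j \<Longrightarrow> v \<in> rel_at i j \<Longrightarrow> u + v \<in> rel_at i j"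
  "u \<in> rel_at i j \<Longrightarrow> tensor_scale c u \<in> rel_at i j"
  by (auto simp: rel_at_def lookup_add)

lemma rel_at_mult:
  assumes "u \<in> tensor_power i" "r \<in> rels" "v \<in> tensor_power j"
  shows "u * r * v \<in> rel_at i j"
  using assms(1)
proof (induction u rule: tensor_power_induct)
  case (word a)
  note a = word
  show ?case
    using assms(3)
  proof (induction v rule: tensor_power_induct)
    case (word b)
    note b = word
    have "rels \<subseteq> {r. word a * r * word b \<in> rel_at i j}"
    proof (rule rels_subset)
      show "word [Gx, Gx] \<in> {r. word a * r * word b \<in> rel_at i j}"
        using a b by (auto simp: rel_at_def word_mult lookup_word)
      show "word [Gy, Gy] - word [Gx, Gy] \<in> {r. word a * r * word b \<in> rel_at i j}"
        using a b by (auto simp: rel_at_def word_mult lookup_word lookup_minus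
            left_diff_distrib right_diff_distrib)
    qed (auto simp: rel_at_closed distrib_left distrib_right tensor_scale_mult_left tensor_scale_mult_right)
    then show ?case
      using assms(2) by auto
  qed (simp_all add: rel_at_closed distrib_left tensor_scale_mult_right)
qed (simp_all add: rel_at_closed distrib_right tensor_scale_mult_left)

text \<open>The upper bound for W_p; \<open>koszul_W_words\<close> supplies explicit elements as the
  lower bound.\<close>

lemma koszul_W_rel_at:
  assumes "u \<in> koszul_W rels p" "p = i + 2 + j"
  shows "u \<in> rel_at i j"
proof -
  have "u \<in> tensor_span {u * r * v | u r v. u \<in> tensor_power i \<and> r \<in> rels \<and> v \<in> tensor_power (p - 2 - i)}"
    using assms by (auto simp: koszul_W_def dest!: bspec[of _ _ i])
  also have "\<dots> \<subseteq> id ` rel_at i j"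
    by (rule presentation.span_subset[OF presentation_tensor_algebra])
      (use assms(2) in \<open>auto simp: rel_at_closed rel_at_mult\<close>)
  finally show ?thesis by simp
qed

lemma koszul_W_length:
  assumes "u \<in> koszul_W rels p" "length w \<noteq> p"
  shows "Poly_Mapping.lookup u w = 0"
proof (cases "p < 2")
  case True
  then show ?thesis
    using assms by (auto simp: koszul_W_def tensor_power_def in_keys_iff)
next
  case False
  then show ?thesis
    using koszul_W_rel_at[OF assms(1), of 0 "p - 2"] assms(2) by (auto simp: rel_at_def)
qed

lemma koszul_W_2:
  assumes "u \<in> koszul_W rels 2"
  shows "Poly_Mapping.lookup u [Gy, Gx] = 0"
    "Poly_Mapping.lookup u [Gx, Gy] = - Poly_Mapping.lookup u [Gy, Gy]"
  using koszul_W_rel_at[OF assms, of 0 0] by (auto simp: rel_at_def)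

text \<open>For \<open>p \<ge> 3\<close> the space \<open>W\<^sub>p\<close> is spanned by \<open>x\<^sup>p\<close>: the coefficient of a word containing \<open>yx\<close>
  vanishes, and so does that of a word ending with \<open>ghy\<close>, by comparison with the one ending with \<open>yxy\<close>.\<close>

lemma koszul_W_ge_3:
  assumes u: "u \<in> koszul_W rels p" and p: "p \<ge> 3" and w: "w \<noteq> replicate p Gx"
  shows "Poly_Mapping.lookup u w = 0"
proof (cases "length w = p")
  case False
  then show ?thesis using koszul_W_length[OF u] by blast
next
  case True
  have rel: "Poly_Mapping.lookup u (a @ [Gy, Gx] @ b) = 0"
    "Poly_Mapping.lookup u (a @ [Gx, Gy] @ b) = - Poly_Mapping.lookup u (a @ [Gy, Gy] @ b)"
    if "length a + length b + 2 = p" for a b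
    using koszul_W_rel_at[OF u, of "length a" "length b"] that by (auto simp: rel_at_def)
  \<comment> \<open>The zero coefficient of yxy propagates: to yyy by the relation in the last two
    places, to xyy by the relation in the first two, and to xxy again by the last two.\<close>
  have yyy: "Poly_Mapping.lookup u (a @ [g, h, Gy]) = 0" if "length a + 3 = p" for a g h
  proof -
    have "Poly_Mapping.lookup u (a @ [Gy, Gx, Gy]) = 0"
      using rel(1)[of a "[Gy]"] that by simp
    moreover have "Poly_Mapping.lookup u (a @ [Gy, Gx, Gy]) = - Poly_Mapping.lookup u (a @ [Gy, Gy, Gy])"
      using rel(2)[of "a @ [Gy]" "[]"] that by simp
    moreover have "Poly_Mapping.lookup u (a @ [Gx, Gy, Gy]) = - Poly_Mapping.lookup u (a @ [Gy, Gy, Gy])"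
      using rel(2)[of a "[Gy]"] that by simp
    moreover have "Poly_Mapping.lookup u (a @ [Gx, Gx, Gy]) = - Poly_Mapping.lookup u (a @ [Gx, Gy, Gy])"
      using rel(2)[of "a @ [Gx]" "[]"] that by simp
    ultimately show ?thesis
      by (cases g; cases h) simp_all
  qed
  have "Gy \<in> set w"
  proof (rule ccontr)
    assume "Gy \<notin> set w"
    then have "\<forall>g\<in>set w. g = Gx"
      by (metis gen.exhaust)
    then show False
      using w True replicate_length_same[of w Gx] by auto
  qed
  \<comment> \<open>At the last y the word either ends or continues with x, which produces a factor
    yx.\<close>
  then obtain a b where ab: "w = a @ Gy # b" "Gy \<notin> set b"
    by (meson split_list_last)
  show ?thesis
  proof (cases b)
    case Nil
    have "length (rev a) \<ge> 2"
      using ab Nil True p by simp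
    then obtain h g a' where "rev a = h # g # a'"
      by (cases "rev a" rule: remdups_adj.cases) auto
    then have "a = rev a' @ [g, h]"
      by (metis append.assoc append_Cons append_Nil rev.simps(2) rev_rev_ident)
    then show ?thesis
      using yyy[of "rev a'" g h] ab Nil True by simp
  next
    case (Cons g b')
    then have "g = Gx"
      using ab(2) by (cases g) auto
    then show ?thesis
      using rel(1)[of a b'] ab Cons True by simp
  qed
qed

text \<open>Any two neighbouring letters of x^p form the relation xx, so x^p lies in every term of
  the intersection.\<close>

lemma koszul_W_words:
  "word (replicate p Gx) \<in> (koszul_W rels p :: (gen, 'k::field) tensor set)"
  "word [Gy] \<in> (koszul_W rels 1 :: (gen, 'k) tensor set)"
  "word [Gy, Gy] - word [Gx, Gy] \<in> (koszul_W rels 2 :: (gen, 'k) tensor set)"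
proof -
  have span: "x \<in> tensor_span B" if "x \<in> B" for x and B :: "(gen, 'k) tensor set"
  proof -
    interpret T: presentation tensor_scale "tensor_algebra :: ('k, (gen, 'k) tensor) module" UNIV "{0}" id
      by (rule presentation_tensor_algebra)
    show ?thesis
      using T.H.in_own_span[of B] that by auto
  qed
  have word_power: "word w \<in> (tensor_power n :: (gen, 'k) tensor set)" if "length w = n" for w n
    using that by (auto simp: tensor_power_def word_def)
  show "word [Gy] \<in> (koszul_W rels 1 :: (gen, 'k) tensor set)"
    by (simp add: koszul_W_def word_power)
  show "word (replicate p Gx) \<in> (koszul_W rels p :: (gen, 'k) tensor set)"
  proof (cases "p < 2")
    case False
    have "(word (replicate p Gx) :: (gen, 'k) tensor)
        \<in> tensor_span {u * r * v |u r v. u \<in> tensor_power i \<and> r \<in> rels \<and> v \<in> tensor_power (p - 2 - i)}"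
      if "i \<le> p - 2" for i
    proof (rule span)
      have "replicate 2 Gx = [Gx, Gx]"
        by (simp add: numeral_2_eq_2)
      then have "replicate (i + 2 + k) Gx = (replicate i Gx @ [Gx, Gx]) @ replicate k Gx" for k
        by (simp only: replicate_add)
      moreover have "i + 2 + (p - 2 - i) = p"
        using that False by simp
      ultimately have "replicate p Gx = (replicate i Gx @ [Gx, Gx]) @ replicate (p - 2 - i) Gx"
        by metis
      then have "word (replicate p Gx) = word (replicate i Gx) * word [Gx, Gx]
          * (word (replicate (p - 2 - i) Gx) :: (gen, 'k) tensor)"
        by (simp only: word_mult)
      then show "(word (replicate p Gx) :: (gen, 'k) tensor)
          \<in> {u * r * v |u r v. u \<in> tensor_power i \<and> r \<in> rels \<and> v \<in> tensor_power (p - 2 - i)}"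
        using rels_gens(1) word_power[OF length_replicate, of i Gx] word_power[OF length_replicate, of "p - 2 - i" Gx]
        by blast
    qed
    with False show ?thesis
      by (auto simp: koszul_W_def)
  qed (simp add: koszul_W_def word_power)
  have "word [Gy, Gy] - word [Gx, Gy] = word [] * (word [Gy, Gy] - word [Gx, Gy]) * (word [] :: (gen, 'k) tensor)"
    by (simp add: word_Nil)
  then have "word [Gy, Gy] - word [Gx, Gy] \<in> {u * r * v |u r v. u \<in> tensor_power 0 \<and> r \<in> rels \<and> v \<in> (tensor_power 0 :: (gen, 'k) tensor set)}"
    using rels_gens(2) word_power[of "[]" 0, OF list.size(3)] by blast
  then show "word [Gy, Gy] - word [Gx, Gy] \<in> (koszul_W rels 2 :: (gen, 'k) tensor set)"
    by (auto simp: koszul_W_def intro!: span)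
qed

section \<open>Koszul chains as pairs of algebra elements\<close>

type_synonym 'k pair = "'k six \<times> 'k six"

definition pair_scale :: "'k::field \<Rightarrow> 'k pair \<Rightarrow> 'k pair" where
  "pair_scale c v = (six_scale c (fst v), six_scale c (snd v))"

text \<open>The pair \<open>(a, c)\<close> stands for \<open>a \<otimes> x\<^sup>p + c \<otimes> W_gen p\<close>. Only \<open>W\<^sub>1\<close> and \<open>W\<^sub>2\<close> are two-dimensional; in the
  other degrees \<open>W_gen\<close> is a junk value and \<open>pairs\<close> forces \<open>c = 0\<close>.\<close>

definition W_gen :: "nat \<Rightarrow> (gen, 'k::field) tensor" where
  "W_gen p = (if p = 1 then word [Gy] else word [Gy, Gy] - word [Gx, Gy])"

definition pairs :: "nat \<Rightarrow> 'k::field pair set" where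
  "pairs p = {(a, c). p = 1 \<or> p = 2 \<or> c = 0}"

definition chain :: "nat \<Rightarrow> 'k::field pair \<Rightarrow> 'k model_chain" where
  "chain p v = (\<lambda>w. six_scale (Poly_Mapping.lookup (word (replicate p Gx)) w) (fst v)
    + six_scale (Poly_Mapping.lookup (W_gen p) w) (snd v))"

lemma vector_space_pair_scale: "vector_space pair_scale"
  by unfold_locales (auto simp: pair_scale_def six.scale_right_distrib six.scale_left_distrib)

lemma pairs_closed:
  "0 \<in> pairs p"
  "v \<in> pairs p \<Longrightarrow> w \<in> pairs p \<Longrightarrow> v + w \<in> pairs p"
  "v \<in> pairs p \<Longrightarrow> pair_scale c v \<in> pairs p"
  by (auto simp: pairs_def pair_scale_def case_prod_unfold)

lemma chain_linear:
  "chain p (v + w) = chain p v + chain p w"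
  "chain p (pair_scale c v) = chain_scale c (chain p v)"
  by (simp_all add: chain_def pair_scale_def chain_scale_def fun_eq_iff six.scale_right_distrib
      mult.commute del: split_paired_All)

lemma chain_zero: "chain p 0 = 0"
  by (simp add: chain_def fun_eq_iff)

lemma chain_1: "chain 1 v w = (if w = [Gx] then fst v else if w = [Gy] then snd v else 0)"
  by (simp add: chain_def W_gen_def lookup_word)

lemma chain_2:
  "chain 2 v w = (if w = [Gx, Gx] then fst v else if w = [Gy, Gy] then snd v
    else if w = [Gx, Gy] then - snd v else 0)"
  by (simp add: chain_def W_gen_def lookup_word lookup_minus numeral_2_eq_2)

lemma chain_other:
  "v \<in> pairs p \<Longrightarrow> p \<noteq> 1 \<Longrightarrow> p \<noteq> 2 \<Longrightarrow> chain p v w = (if w = replicate p Gx then fst v else 0)"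
  by (auto simp: chain_def lookup_word pairs_def)

lemma chain_length: "v \<in> pairs p \<Longrightarrow> length w \<noteq> p \<Longrightarrow> chain p v w = 0"
  by (cases "p = 1"; cases "p = 2") (auto simp: chain_1 chain_2 chain_other simp del: One_nat_def)

lemma chain_eq_0:
  assumes "v \<in> pairs p" "chain p v = 0"
  shows "v = 0"
proof -
  have *: "chain p v w = 0" for w
    using assms(2) by simp
  consider "p = 1" | "p = 2" | "p \<noteq> 1" "p \<noteq> 2" by blast
  then show ?thesis
  proof cases
    case 1
    then show ?thesis
      using *[of "[Gx]"] *[of "[Gy]"] by (simp add: chain_1 prod_eq_iff del: One_nat_def)
  next
    case 2
    then show ?thesis
      using *[of "[Gx, Gx]"] *[of "[Gy, Gy]"] by (simp add: chain_2 prod_eq_iff)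
  next
    case 3
    then show ?thesis
      using *[of "replicate p Gx"] assms(1) by (auto simp add: chain_other pairs_def zero_prod_def simp del: One_nat_def)
  qed
qed

lemma scaled_W_chain:
  assumes u: "u \<in> koszul_W rels p"
  shows "\<exists>v\<in>pairs p. (\<lambda>w. six_scale (Poly_Mapping.lookup u w) a) = chain p v"
proof -
  have len: "Poly_Mapping.lookup u w = 0" if "length w \<noteq> p" for w
    using koszul_W_length[OF u that] .
  consider "p = 1" | "p = 2" | "p = 0" | "p \<ge> 3" by linarith
  then show ?thesis
  proof cases
    case 1
    let ?v = "(six_scale (Poly_Mapping.lookup u [Gx]) a, six_scale (Poly_Mapping.lookup u [Gy]) a)"
    have "six_scale (Poly_Mapping.lookup u w) a = chain p ?v w" for w
    proof (cases "length w = 1")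
      case True
      then obtain g where "w = [g]"
        by (auto simp: length_Suc_conv)
      then show ?thesis
        unfolding 1 by (cases g) (simp_all add: chain_1 del: One_nat_def)
    next
      case False
      then show ?thesis
        using len[of w] unfolding 1 by (auto simp: chain_1 simp del: One_nat_def)
    qed
    then have "(\<lambda>w. six_scale (Poly_Mapping.lookup u w) a) = chain p ?v"
      by (rule ext)
    moreover have "?v \<in> pairs p"
      by (simp add: pairs_def 1)
    ultimately show ?thesis
      by (rule bexI)
  next
    case 2
    \<comment> \<open>The coefficient at yy is that of the generator y^2 - xy; the equations for W_2
      force its negative at xy and zero at yx.\<close>
    let ?v = "(six_scale (Poly_Mapping.lookup u [Gx, Gx]) a, six_scale (Poly_Mapping.lookup u [Gy, Gy]) a)"
    have "six_scale (Poly_Mapping.lookup u w) a = chain p ?v w" for w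
    proof (cases "length w = 2")
      case True
      then obtain g h where "w = [g, h]"
        by (auto simp: length_Suc_conv numeral_2_eq_2)
      then show ?thesis
        using koszul_W_2[OF u[unfolded 2]] unfolding 2 by (cases g; cases h) (simp_all add: chain_2)
    next
      case False
      then show ?thesis
        using len[of w] unfolding 2 by (auto simp: chain_2)
    qed
    then have "(\<lambda>w. six_scale (Poly_Mapping.lookup u w) a) = chain p ?v"
      by (rule ext)
    moreover have "?v \<in> pairs p"
      by (simp add: pairs_def 2)
    ultimately show ?thesis
      by (rule bexI)
  next
    case 3
    let ?v = "(six_scale (Poly_Mapping.lookup u []) a, 0)"
    have "six_scale (Poly_Mapping.lookup u w) a = chain p ?v w" for w
      using len[of w] 3 by (auto simp: chain_other pairs_def)
    then have "(\<lambda>w. six_scale (Poly_Mapping.lookup u w) a) = chain p ?v"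
      by (rule ext)
    moreover have "?v \<in> pairs p"
      by (simp add: pairs_def)
    ultimately show ?thesis
      by (rule bexI)
  next
    case 4
    let ?v = "(six_scale (Poly_Mapping.lookup u (replicate p Gx)) a, 0)"
    have "six_scale (Poly_Mapping.lookup u w) a = chain p ?v w" for w
      using koszul_W_ge_3[OF u 4, of w] 4 by (auto simp: chain_other pairs_def)
    then have "(\<lambda>w. six_scale (Poly_Mapping.lookup u w) a) = chain p ?v"
      by (rule ext)
    moreover have "?v \<in> pairs p"
      by (simp add: pairs_def)
    ultimately show ?thesis
      by (rule bexI)
  qed
qed

text \<open>Each pure tensor a \<otimes> u with u in W_p is a chain of a pair, and conversely each
  such chain is a sum of at most two pure tensors. Injectivity of \<open>chain\<close> on
  \<open>pairs\<close> then makes the kernel zero.\<close>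

lemma presentation_koszul_chains:
  "presentation pair_scale (koszul_chains rels p) (pairs p) {0}
    (\<lambda>v :: 'k::field pair. chain_of (chain p v))"
proof -
  let ?T = "tensor_chains rels p :: ('k, gen list \<Rightarrow> (gen, 'k) tensor set) module"
  let ?L = "{F :: 'k model_chain. \<forall>w. length w \<noteq> p \<longrightarrow> F w = 0}"
  let ?X = "{pure_tensor rels a u | a u. a \<in> carrier (quadratic_algebra rels) \<and> u \<in> koszul_W rels p}
    :: (gen list \<Rightarrow> (gen, 'k) tensor set) set"
  interpret T: presentation chain_scale ?T ?L "{0}" chain_of
    by (rule presentation_tensor_chains)
  interpret Q: presentation six_scale "quadratic_algebra rels :: ('k, (gen, 'k) tensor set) module"
      UNIV "{0}" alg_of
    by (rule presentation_quadratic)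
  let ?S = "chain p ` pairs p :: 'k model_chain set"
  have S1: "?S \<subseteq> ?L"
  proof
    fix F assume "F \<in> ?S"
    then obtain v where "v \<in> pairs p" "F = chain p v"
      by (rule imageE)
    then show "F \<in> ?L"
      using chain_length[of v p] by simp
  qed
  have S2: "0 \<in> ?S"
    by (rule image_eqI[of _ _ 0]) (simp_all add: chain_zero pairs_closed)
  have S3: "F + G \<in> ?S" if "F \<in> ?S" "G \<in> ?S" for F G
    using that by (elim imageE) (simp add: pairs_closed flip: chain_linear)
  have S4: "chain_scale c F \<in> ?S" if "F \<in> ?S" for c F
    using that by (elim imageE) (simp add: pairs_closed flip: chain_linear)
  note S = S1 S2 S3 S4
  have X: "?X \<subseteq> chain_of ` ?S"
  proof
    fix f assume "f \<in> ?X"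
    then obtain a' u where a': "a' \<in> carrier (quadratic_algebra rels)"
      and u: "u \<in> koszul_W rels p" and f: "f = pure_tensor rels a' u"
      by blast
    obtain a where "a' = alg_of a"
      using a' unfolding Q.image[symmetric] by (rule imageE)
    then have "f = chain_of (\<lambda>w. six_scale (Poly_Mapping.lookup u w) a)"
      by (simp only: f pure_tensor_chain_of)
    moreover obtain v where "v \<in> pairs p" "(\<lambda>w. six_scale (Poly_Mapping.lookup u w) a) = chain p v"
      using scaled_W_chain[OF u, of a] by (rule bexE)
    ultimately show "f \<in> chain_of ` ?S"
      by (simp only: imageI)
  qed
  have XT: "?X \<subseteq> carrier ?T"
    using X image_mono[OF S(1), of chain_of] T.image by (simp only: subset_trans)
  have "T.H.span ?X = chain_of ` ?S"
  proof
    show "T.H.span ?X \<subseteq> chain_of ` ?S"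
      by (rule T.span_subset[OF X S])
    interpret sub: LinearCombinations.submodule scalars "T.H.span ?X" ?T
      by (rule T.H.span_is_submodule[OF XT])
    have *: "chain_of (\<lambda>w. six_scale (Poly_Mapping.lookup u w) a) \<in> T.H.span ?X"
      if "u \<in> koszul_W rels p" for a and u :: "(gen, 'k) tensor"
    proof -
      have "pure_tensor rels (alg_of a) u \<in> ?X"
        using that Q.q_closed[OF UNIV_I, of a] by blast
      then show ?thesis
        unfolding pure_tensor_chain_of by (rule subsetD[OF T.H.in_own_span[OF XT]])
    qed
    show "chain_of ` ?S \<subseteq> T.H.span ?X"
    proof
      fix f assume "f \<in> chain_of ` ?S"
      then obtain v where v: "v \<in> pairs p" "f = chain_of (chain p v)"
        by blast
      define F where "F = (\<lambda>w. six_scale (Poly_Mapping.lookup (word (replicate p Gx)) w) (fst v))"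
      define G where "G = (\<lambda>w. six_scale (Poly_Mapping.lookup (W_gen p) w) (snd v))"
      have F: "chain_of F \<in> T.H.span ?X"
        unfolding F_def by (rule *[OF koszul_W_words(1)])
      show "f \<in> T.H.span ?X"
      proof (cases "p = 1 \<or> p = 2")
        case True
        then have G: "chain_of G \<in> T.H.span ?X"
          unfolding G_def using koszul_W_words(2,3) by (intro *) (auto simp: W_gen_def)
        have "F \<in> ?L" "G \<in> ?L"
          using True by (auto simp: F_def G_def lookup_word W_gen_def lookup_minus)
        then have "f = chain_of F \<oplus>\<^bsub>?T\<^esub> chain_of G"
          using v(2) by (simp add: T.q_add[symmetric] F_def G_def chain_def plus_fun_def)
        then show ?thesis
          using F G by simp
      next
        case False
        \<comment> \<open>Here \<open>W_gen p\<close> is a junk value that does not belong to W_p;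
          the vanishing second component removes it.\<close>
        then have "snd v = 0"
          using v(1) by (auto simp: pairs_def)
        then have "chain p v = F"
          by (simp add: chain_def F_def)
        then show ?thesis
          using v(2) F by simp
      qed
    qed
  qed
  then have K: "koszul_chains rels p = ?T\<lparr>carrier := chain_of ` ?S\<rparr>"
    by (simp add: koszul_chains_def)
  interpret K: presentation chain_scale "koszul_chains rels p" ?S "{0} \<inter> ?S" chain_of
    unfolding K by (rule T.subobject[OF S])
  show ?thesis
    by (rule K.reparam)
      (use K.image chain_eq_0 in \<open>auto simp: vector_space_pair_scale pairs_closed chain_linear chain_zero
        simp del: split_paired_All split_paired_Ex\<close>)
qed

section \<open>Koszul homology and higher Koszul homology\<close>

text \<open>In degree 2 the sign is -1 and both words of y^2 - xy end in y, so c \<otimes> (y^2 -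
  xy) contributes yc to the coefficient of x and -yc to that of y.\<close>

definition cap_pair :: "nat \<Rightarrow> 'k::field pair \<Rightarrow> 'k pair" where
  "cap_pair p v = (if p = 0 then 0
    else if p = 1 then (left Gx (fst v) + left Gy (snd v), 0)
    else if p = 2 then (left Gy (snd v) - left Gx (fst v), - left Gy (snd v))
    else (six_scale ((- 1) ^ (p - 1)) (left Gx (fst v)), 0))"

definition right_pair :: "nat \<Rightarrow> 'k::field pair \<Rightarrow> 'k pair" where
  "right_pair p v = (if p = 0 then 0
    else if p = 1 then (right Gx (fst v) + right Gy (snd v), 0)
    else if p = 2 then (right Gx (fst v), right Gy (snd v) - right Gx (snd v))
    else (right Gx (fst v), 0))"

definition b_pair :: "nat \<Rightarrow> 'k::field pair \<Rightarrow> 'k pair" where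
  "b_pair p v = right_pair p v - cap_pair p v"

lemma left_minus: "left g (- v) = - left g v" "left g (v - w) = left g v - left g w"
proof -
  have *: "left g (- v) = - left g v" for v :: "'a six"
    using left_scale[of g "- 1" v] by (simp only: six.scale_minus_left six.scale_one)
  then show "left g (- v) = - left g v" .
  show "left g (v - w) = left g v - left g w"
    by (simp only: diff_conv_add_uminus left_add *)
qed

lemma right_minus: "right g (- v) = - right g v" "right g (v - w) = right g v - right g w"
proof -
  have *: "right g (- v) = - right g v" for v :: "'a six"
    using right_scale[of g "- 1" v] by (simp only: six.scale_minus_left six.scale_one)
  then show "right g (- v) = - right g v" .
  show "right g (v - w) = right g v - right g w"
    by (simp only: diff_conv_add_uminus right_add *)
qed

lemma cap_pair_linear:
  "cap_pair p (v + w) = cap_pair p v + cap_pair p w"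
  "cap_pair p (pair_scale c v) = pair_scale c (cap_pair p v)"
proof -
  show "cap_pair p (v + w) = cap_pair p v + cap_pair p w"
    by (simp add: cap_pair_def prod_eq_iff left_add six.scale_right_distrib)
  show "cap_pair p (pair_scale c v) = pair_scale c (cap_pair p v)"
    by (simp add: cap_pair_def pair_scale_def left_scale prod_eq_iff six.scale_right_diff_distrib
        six.scale_right_distrib six.scale_left_commute del: six.scale_scale)
qed

lemma right_pair_linear:
  "right_pair p (v + w) = right_pair p v + right_pair p w"
  "right_pair p (pair_scale c v) = pair_scale c (right_pair p v)"
proof -
  show "right_pair p (v + w) = right_pair p v + right_pair p w"
    by (simp add: right_pair_def prod_eq_iff right_add six.scale_right_distrib)
  show "right_pair p (pair_scale c v) = pair_scale c (right_pair p v)"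
    by (simp add: right_pair_def pair_scale_def right_scale prod_eq_iff six.scale_right_diff_distrib
        six.scale_right_distrib six.scale_left_commute del: six.scale_scale)
qed

lemma b_pair_linear:
  "b_pair p (v + w) = b_pair p v + b_pair p w"
  "b_pair p (pair_scale c v) = pair_scale c (b_pair p v)"
  by (simp_all add: b_pair_def cap_pair_linear right_pair_linear)
    (simp add: pair_scale_def six.scale_right_diff_distrib)

lemma pair_maps_closed:
  "v \<in> pairs p \<Longrightarrow> cap_pair p v \<in> pairs (p - 1)"
  "v \<in> pairs p \<Longrightarrow> b_pair p v \<in> pairs (p - 1)"
  by (auto simp: pairs_def b_pair_def right_pair_def cap_pair_def zero_prod_def)

lemma chain_snd_0: "snd v = 0 \<Longrightarrow> chain p v w = (if w = replicate p Gx then fst v else 0)"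
  by (simp add: chain_def lookup_word)

lemma replicate_eq_snoc:
  "u @ [g] = replicate p h \<longleftrightarrow> p > 0 \<and> g = h \<and> u = replicate (p - 1) h"
proof (cases p)
  case (Suc n)
  have "replicate (Suc n) h = replicate n h @ [h]"
    by (simp add: replicate_append_same)
  then show ?thesis
    unfolding Suc by auto
qed simp

lemma replicate_eq_Cons:
  "g # u = replicate p h \<longleftrightarrow> p > 0 \<and> g = h \<and> u = replicate (p - 1) h"
  by (cases p) auto

lemma gen_list_cases:
  obtains "w = []" | "w = [Gx]" | "w = [Gy]" | g h w' where "w = g # h # w'"
  by (cases w rule: remdups_adj.cases) (metis gen.exhaust)+

lemma cap_model_chain:
  assumes "v \<in> pairs p" "p > 0"
  shows "cap_model p (chain p v) = chain (p - 1) (cap_pair p v)"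
proof
  fix u
  consider "p = 1" | "p = 2" | "p \<ge> 3" using assms(2) by linarith
  then show "cap_model p (chain p v) u = chain (p - 1) (cap_pair p v) u"
  proof cases
    case 1
    then show ?thesis
      by (simp add: cap_model_def chain_1 chain_snd_0 cap_pair_def del: One_nat_def)
  next
    case 2
    have "cap_model 2 (chain 2 v) u = chain 1 (cap_pair 2 v) u"
      by (cases u rule: gen_list_cases)
        (auto simp: cap_model_def chain_1 chain_2 cap_pair_def left_minus simp del: One_nat_def)
    then show ?thesis
      by (simp add: 2)
  next
    case 3
    then have "snd v = 0"
      using assms(1) by (auto simp: pairs_def)
    then show ?thesis
      using 3 by (simp add: cap_model_def chain_snd_0 cap_pair_def replicate_eq_snoc)
  qed
qed

lemma right_model_chain:
  assumes "v \<in> pairs p" "p > 0"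
  shows "right_model (chain p v) = chain (p - 1) (right_pair p v)"
proof
  fix u
  consider "p = 1" | "p = 2" | "p \<ge> 3" using assms(2) by linarith
  then show "right_model (chain p v) u = chain (p - 1) (right_pair p v) u"
  proof cases
    case 1
    then show ?thesis
      by (simp add: right_model_def chain_1 chain_snd_0 right_pair_def del: One_nat_def)
  next
    case 2
    have "right_model (chain 2 v) u = chain 1 (right_pair 2 v) u"
      by (cases u rule: gen_list_cases)
        (auto simp: right_model_def chain_1 chain_2 right_pair_def right_minus simp del: One_nat_def)
    then show ?thesis
      by (simp add: 2)
  next
    case 3
    then have "snd v = 0"
      using assms(1) by (auto simp: pairs_def)
    then show ?thesis
      using 3 by (simp add: right_model_def chain_snd_0 right_pair_def replicate_eq_Cons)
  qed
qed

abbreviation koszul_elem :: "nat \<Rightarrow> 'k::field pair \<Rightarrow> gen list \<Rightarrow> (gen, 'k) tensor set" where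
  "koszul_elem p v \<equiv> chain_of (chain p v)"

lemma chain_of_0: "chain_of 0 = \<zero>\<^bsub>tensor_chains rels p\<^esub>"
  using presentation.q_zero[OF presentation_tensor_chains] .

lemma koszul_cap_elem:
  assumes "v \<in> pairs p"
  shows "koszul_cap rels p (koszul_elem p v) = koszul_elem (p - 1) (cap_pair p v)"
proof (cases "p = 0")
  case True
  then show ?thesis
    by (simp add: koszul_cap_def cap_pair_def chain_zero flip: chain_of_0[of 0])
next
  case False
  then show ?thesis
    using chain_length[OF assms] by (simp add: koszul_cap_chain_of cap_model_chain[OF assms] del: One_nat_def)
qed

lemma koszul_b_elem:
  assumes "v \<in> pairs p"
  shows "koszul_b rels p (koszul_elem p v) = koszul_elem (p - 1) (b_pair p v)"
proof (cases "p = 0")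
  case True
  then show ?thesis
    by (simp add: koszul_b_def b_pair_def right_pair_def cap_pair_def chain_zero flip: chain_of_0[of 0])
next
  case False
  have "chain (p - 1) (b_pair p v) = chain (p - 1) (right_pair p v) - chain (p - 1) (cap_pair p v)"
    using chain_linear(1)[of "p - 1" "b_pair p v" "cap_pair p v"] by (simp add: b_pair_def)
  then show ?thesis
    using False chain_length[OF assms]
    by (simp add: koszul_b_chain_of cap_model_chain[OF assms] right_model_chain[OF assms] del: One_nat_def)
qed

lemma left_left: "left Gx (left Gx v) = 0" "left Gy (left Gy v) = left Gx (left Gy v)"
  by (cases v; simp add: zero_prod_def)+

lemma right_right: "right Gx (right Gx v) = 0" "right Gy (right Gy v) = right Gy (right Gx v)"
  by (cases v; simp add: zero_prod_def)+

text \<open>The squares vanish because left and right multiplication satisfy x^2 = 0 and y^2 = xy.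
  The mixed identity combines \<open>left_right\<close> with the sign change of cap between adjacent
  degrees. With b = r - cap this gives b b = 0 and cap b = - b cap.\<close>

lemma pair_maps_compose:
  assumes "v \<in> pairs (Suc p)"
  shows "cap_pair p (cap_pair (Suc p) v) = 0"
    "right_pair p (right_pair (Suc p) v) = 0"
    "right_pair p (cap_pair (Suc p) v) = - cap_pair p (right_pair (Suc p) v)"
proof -
  have "snd v = 0" if "p \<ge> 2"
    using assms that by (auto simp: pairs_def)
  then consider "p = 0" | "p = 1" | "p = 2" "snd v = 0" | "p \<ge> 3" "snd v = 0"
    by (metis One_nat_def Suc_1 less_2_cases not_less numeral_3_eq_3 order_le_less Suc_leI)
  note cases = this
  have power: "(- 1) ^ p = - ((- 1) ^ (p - 1) :: 'a)" if "p \<ge> 3"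
    using that by (cases p) auto
  show "cap_pair p (cap_pair (Suc p) v) = 0"
    by (rule cases) (simp_all add: cap_pair_def left_minus left_scale left_left zero_prod_def[where 'a = "'a six"])
  show "right_pair p (right_pair (Suc p) v) = 0"
    by (rule cases) (simp_all add: right_pair_def right_minus right_right zero_prod_def[where 'a = "'a six"])
  show "right_pair p (cap_pair (Suc p) v) = - cap_pair p (right_pair (Suc p) v)"
    by (rule cases) (simp_all add: right_pair_def cap_pair_def right_minus left_minus right_add left_add
      right_scale left_scale left_right power)
qed

interpretation pair: vector_space pair_scale
  by (rule vector_space_pair_scale)

lemma pair_maps_diff:
  "cap_pair p (v - w) = cap_pair p v - cap_pair p w"
  "right_pair p (v - w) = right_pair p v - right_pair p w"
  using cap_pair_linear(1)[of p "v - w" w] right_pair_linear(1)[of p "v - w" w]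
  by (metis diff_add_cancel eq_diff_eq)+

lemma b_pair_uminus: "b_pair p (- v) = - b_pair p v"
  using b_pair_linear(2)[of p "- 1" v] by (simp only: pair.scale_minus_left pair.scale_one)

lemma b_pair_square: "v \<in> pairs (Suc p) \<Longrightarrow> b_pair p (b_pair (Suc p) v) = 0"
  by (simp add: b_pair_def pair_maps_diff pair_maps_compose)

lemma cap_b_pair: "v \<in> pairs (Suc p) \<Longrightarrow> cap_pair p (b_pair (Suc p) v) = - b_pair p (cap_pair (Suc p) v)"
  by (simp add: b_pair_def pair_maps_diff pair_maps_compose)

section \<open>Koszul homology and the induced cap product in pair coordinates\<close>

definition hk_cycles :: "nat \<Rightarrow> 'k::field pair set" where
  "hk_cycles p = {v \<in> pairs p. b_pair p v = 0}"

definition hk_bounds :: "nat \<Rightarrow> 'k::field pair set" where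
  "hk_bounds p = b_pair (Suc p) ` pairs (Suc p)"

lemma presentation_HK:
  "presentation pair_scale (HK rels p) (hk_cycles p) (hk_bounds p)
    (\<lambda>v :: 'k::field pair. HK_class rels p (koszul_elem p v))"
proof -
  have "presentation pair_scale (HK rels p) {v \<in> pairs p. b_pair p v \<in> {0}}
    {k + b_pair (Suc p) u | k u. k \<in> {0} \<and> u \<in> pairs (Suc p)}
    (\<lambda>v :: 'k pair. HK_class rels p (koszul_elem p v))"
    by (rule homology_presentation[where S = pairs and K = "\<lambda>_. {0}" and q = koszul_elem])
      (simp_all add: presentation_koszul_chains koszul_b_elem pair_maps_closed b_pair_linear
        b_pair_square del: One_nat_def)
  moreover have "{v :: 'k pair. v \<in> pairs p \<and> b_pair p v \<in> {0}} = hk_cycles p"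
    by (simp add: hk_cycles_def)
  moreover have "{k + b_pair (Suc p) u | k u :: 'k pair. k \<in> {0} \<and> u \<in> pairs (Suc p)} = hk_bounds p"
    by (auto simp: hk_bounds_def simp del: split_paired_Ex)
  ultimately show ?thesis by (simp only:)
qed

text \<open>\<open>HK_cap\<close> takes a union over all representatives of a class, so the class is
  needed explicitly as a set of chains.\<close>

lemma HK_class_elem:
  fixes v :: "'k::field pair"
  assumes "v \<in> pairs p"
  shows "HK_class rels p (koszul_elem p v) = koszul_elem p ` ((\<lambda>k. k + v) ` hk_bounds p)"
proof -
  interpret C: presentation pair_scale "koszul_chains rels p :: ('k, gen list \<Rightarrow> (gen, 'k) tensor set) module"
      "pairs p" "{0}" "koszul_elem p"
    by (rule presentation_koszul_chains)
  interpret C1: presentation pair_scale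
      "koszul_chains rels (Suc p) :: ('k, gen list \<Rightarrow> (gen, 'k) tensor set) module"
      "pairs (Suc p)" "{0}" "koszul_elem (Suc p)"
    by (rule presentation_koszul_chains)
  have bounds: "b_pair (Suc p) u \<in> pairs p" if "u \<in> pairs (Suc p)" for u :: "'k pair"
    using pair_maps_closed(2)[OF that] by simp
  have "boundaries (koszul_chains rels) (koszul_b rels) p = koszul_elem p ` (hk_bounds p :: 'k pair set)"
    unfolding boundaries_def C1.image[symmetric] hk_bounds_def image_image
    by (rule image_cong[OF refl]) (simp add: koszul_b_elem)
  then have "HK_class rels p (koszul_elem p v)
      = (\<Union>k\<in>hk_bounds p. {koszul_elem p k \<oplus>\<^bsub>koszul_chains rels p\<^esub> koszul_elem p v})"
    by (simp add: homology_class_def a_r_coset_def')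
  also have "\<dots> = (\<Union>k\<in>hk_bounds p. {koszul_elem p (k + v)})"
  proof (rule SUP_cong[OF refl])
    fix k :: "'k pair" assume "k \<in> hk_bounds p"
    then have "k \<in> pairs p"
      unfolding hk_bounds_def using bounds by blast
    then show "{koszul_elem p k \<oplus>\<^bsub>koszul_chains rels p\<^esub> koszul_elem p v} = {koszul_elem p (k + v)}"
      by (simp only: C.q_add assms)
  qed
  finally show ?thesis
    by (simp add: image_image UNION_singleton_eq_range)
qed

text \<open>For positive degree this is the anticommutation cap b = - b cap.\<close>

lemma cap_pair_hk_bounds:
  assumes "v \<in> hk_bounds p"
  shows "cap_pair p v \<in> hk_bounds (p - 1)"
proof (cases p)
  case 0
  \<comment> \<open>Truncated subtraction makes the target degree 0 again, where the zero map lands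
    in any subspace.\<close>
  then have "cap_pair p v = b_pair (Suc 0) 0"
    using b_pair_linear(1)[of "Suc 0" 0 0] by (simp add: cap_pair_def)
  then show ?thesis
    unfolding 0 hk_bounds_def by (simp only: diff_0_eq_0 imageI[OF pairs_closed(1)])
next
  case (Suc n)
  obtain u where u: "u \<in> pairs (Suc p)" "v = b_pair (Suc p) u"
    using assms unfolding hk_bounds_def by (rule imageE)
  then have "cap_pair p v = b_pair p (- cap_pair (Suc p) u)"
    by (simp only: cap_b_pair b_pair_uminus)
  moreover have "- cap_pair (Suc p) u \<in> pairs p"
    using pairs_closed(3)[OF pair_maps_closed(1)[OF u(1)], of "- 1"]
    by (simp only: pair.scale_minus_left pair.scale_one diff_Suc_1)
  ultimately show ?thesis
    unfolding hk_bounds_def Suc by simp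
qed

lemma cap_pair_hk_cycles:
  assumes "v \<in> hk_cycles p"
  shows "cap_pair p v \<in> hk_cycles (p - 1)"
proof (cases p)
  case 0
  have "b_pair 0 0 = (0 :: 'a pair)"
    using b_pair_linear(1)[of 0 0 0] by simp
  then show ?thesis
    unfolding 0 hk_cycles_def using pairs_closed(1) by (simp add: cap_pair_def)
next
  case (Suc n)
  have "b_pair n (cap_pair (Suc n) v) = - cap_pair n (b_pair (Suc n) v)"
    using assms cap_b_pair[of v n] by (simp add: hk_cycles_def Suc)
  moreover have "b_pair (Suc n) v = 0" "cap_pair n 0 = (0 :: 'a pair)"
    using assms cap_pair_linear(1)[of n 0 0] by (simp_all add: hk_cycles_def Suc)
  ultimately show ?thesis
    using assms pair_maps_closed(1)[of v p] by (simp add: hk_cycles_def Suc)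
qed

text \<open>Changing the representative by a boundary changes its cap product by a boundary. The
  union defining \<open>HK_cap\<close> therefore runs over equal sets, and its index set is
  nonempty.\<close>

lemma HK_cap_elem:
  fixes v :: "'k::field pair"
  assumes "v \<in> hk_cycles p"
  shows "HK_cap rels p (HK_class rels p (koszul_elem p v))
    = HK_class rels (p - 1) (koszul_elem (p - 1) (cap_pair p v))"
proof -
  interpret H: presentation pair_scale
      "HK rels (p - 1) :: ('k, (gen list \<Rightarrow> (gen, 'k) tensor set) set) module"
      "hk_cycles (p - 1)" "hk_bounds (p - 1)" "\<lambda>v. HK_class rels (p - 1) (koszul_elem (p - 1) v)"
    by (rule presentation_HK)
  interpret Hp: presentation pair_scale
      "HK rels p :: ('k, (gen list \<Rightarrow> (gen, 'k) tensor set) set) module"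
      "hk_cycles p" "hk_bounds p" "\<lambda>v. HK_class rels p (koszul_elem p v)"
    by (rule presentation_HK)
  have v: "v \<in> pairs p"
    using assms by (simp add: hk_cycles_def)
  have *: "HK_class rels (p - 1) (koszul_cap rels p (koszul_elem p (k + v)))
      = HK_class rels (p - 1) (koszul_elem (p - 1) (cap_pair p v))" if k: "k \<in> hk_bounds p" for k
  proof -
    have kv: "k + v \<in> hk_cycles p"
      using Hp.add_S[OF Hp.kernelD(1)[OF k] assms] .
    then have "koszul_cap rels p (koszul_elem p (k + v)) = koszul_elem (p - 1) (cap_pair p (k + v))"
      by (intro koszul_cap_elem) (simp add: hk_cycles_def)
    moreover have "cap_pair p (k + v) - cap_pair p v \<in> hk_bounds (p - 1)"
      using cap_pair_hk_bounds[OF k] by (simp add: cap_pair_linear)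
    ultimately show ?thesis
      using H.q_eq_iff[OF cap_pair_hk_cycles[OF kv] cap_pair_hk_cycles[OF assms]] by (simp only:)
  qed
  have "HK_cap rels p (HK_class rels p (koszul_elem p v))
      = (\<Union>k\<in>hk_bounds p. HK_class rels (p - 1) (koszul_cap rels p (koszul_elem p (k + v))))"
    unfolding HK_cap_def HK_class_elem[OF v] image_image by simp
  also have "\<dots> = (\<Union>k\<in>(hk_bounds p :: 'k pair set). HK_class rels (p - 1) (koszul_elem (p - 1) (cap_pair p v)))"
    by (rule SUP_cong[OF refl *])
  also have "\<dots> = HK_class rels (p - 1) (koszul_elem (p - 1) (cap_pair p v))"
    using Hp.zero_K by (rule UN_constant_eq) simp
  finally show ?thesis .
qed

text \<open>Higher classes are represented by the same pairs of six-tuples as the chains. Vanishing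
  in the iterated homology thus becomes membership in one explicit subspace of pairs.\<close>

lemma presentation_HKhi:
  "presentation pair_scale (HKhi rels p) {v \<in> hk_cycles p. cap_pair p v \<in> hk_bounds (p - 1)}
    {k + cap_pair (Suc p) u | k u. k \<in> hk_bounds p \<and> u \<in> hk_cycles (Suc p)}
    (\<lambda>v :: 'k::field pair. HKhi_class rels p (HK_class rels p (koszul_elem p v)))"
proof (rule homology_presentation[where S = hk_cycles and K = hk_bounds
      and q = "\<lambda>p v. HK_class rels p (koszul_elem p v)"])
  fix p and v :: "'k pair" assume v: "v \<in> hk_cycles (Suc p)"
  interpret Hp: presentation pair_scale
      "HK rels (p - 1) :: ('k, (gen list \<Rightarrow> (gen, 'k) tensor set) set) module"
      "hk_cycles (p - 1)" "hk_bounds (p - 1)" "\<lambda>v. HK_class rels (p - 1) (koszul_elem (p - 1) v)"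
    by (rule presentation_HK)
  have "cap_pair p (cap_pair (Suc p) v) = 0"
    using v by (intro pair_maps_compose) (simp add: hk_cycles_def)
  then show "cap_pair p (cap_pair (Suc p) v) \<in> hk_bounds (p - 1)"
    using Hp.zero_K by simp
qed (use presentation_HK HK_cap_elem cap_pair_hk_cycles cap_pair_linear in blast)+

definition hkhi_bounds :: "nat \<Rightarrow> 'k::field pair set" where
  "hkhi_bounds p = {k + cap_pair (Suc p) u | k u. k \<in> hk_bounds p \<and> u \<in> hk_cycles (Suc p)}"

lemma hkhi_boundsI:
  "v = b_pair q w + cap_pair q u \<Longrightarrow> w \<in> pairs q \<Longrightarrow> u \<in> hk_cycles q \<Longrightarrow> q = Suc p
    \<Longrightarrow> v \<in> hkhi_bounds p"
  unfolding hkhi_bounds_def hk_bounds_def by blast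

lemma hkhi_boundsE:
  assumes "v \<in> hkhi_bounds p" "q = Suc p"
  obtains w u where "v = b_pair q w + cap_pair q u" "w \<in> pairs q" "u \<in> hk_cycles q"
  using assms unfolding hkhi_bounds_def hk_bounds_def by blast

section \<open>Linear algebra in each degree\<close>

lemma b_pair_1:
  "b_pair 1 ((a1, ax, ay, axy, ayx, axyx), (c1, cx, cy, cxy, cyx, cxyx))
    = ((0, 0, 0, cx - ay, ay - cx, axy - ayx - cyx), 0)"
  by (simp add: b_pair_def right_pair_def cap_pair_def)

lemma b_pair_2:
  "b_pair 2 ((a1, ax, ay, axy, ayx, axyx), (c1, cx, cy, cxy, cyx, cxyx))
    = ((0, 2 * a1, - c1, ay - cy, ay - cx, axy + ayx - cyx), (0, - c1, 2 * c1, cx + 2 * cy, cx - cy, cyx - cxy))"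
  by (simp add: b_pair_def right_pair_def cap_pair_def)

lemma b_pair_ge_3:
  "p \<ge> 3 \<Longrightarrow> b_pair p ((a1, ax, ay, axy, ayx, axyx), c)
    = (if odd p then ((0, 0, 0, - ay, ay, axy - ayx), 0) else ((0, 2 * a1, 0, ay, ay, axy + ayx), 0))"
  by (auto simp: b_pair_def right_pair_def cap_pair_def six_scale_def)

lemma cap_pair_1:
  "cap_pair 1 ((a1, ax, ay, axy, ayx, axyx), (c1, cx, cy, cxy, cyx, cxyx))
    = ((0, a1, c1, ay + cy, cx, ayx + cyx), 0)"
  by (simp add: cap_pair_def)

lemma cap_pair_2:
  "cap_pair 2 ((a1, ax, ay, axy, ayx, axyx), (c1, cx, cy, cxy, cyx, cxyx))
    = ((0, - a1, c1, cy - ay, cx, cyx - ayx), (0, 0, - c1, - cy, - cx, - cyx))"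
  by (simp add: cap_pair_def)

lemma cap_pair_ge_3:
  "p \<ge> 3 \<Longrightarrow> cap_pair p ((a1, ax, ay, axy, ayx, axyx), c)
    = (if odd p then ((0, a1, 0, ay, 0, ayx), 0) else ((0, - a1, 0, - ay, 0, - ayx), 0))"
  by (auto simp: cap_pair_def six_scale_def)

lemma pair_cases:
  obtains a1 ax ay axy ayx axyx c1 cx cy cxy cyx cxyx
  where "v = ((a1, ax, ay, axy, ayx, axyx), (c1, cx, cy, cxy, cyx, cxyx))"
  by (metis surj_pair)

lemma pairs_iff: "(a, c) \<in> pairs p \<longleftrightarrow> p = 1 \<or> p = 2 \<or> c = 0"
  by (simp add: pairs_def)

lemma hkhi_bounds_0: "hkhi_bounds 0 = {v \<in> pairs 0. fst (fst v) = (0 :: 'k::field)}"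
proof (rule Set.set_eqI)
  fix v :: "'k pair"
  obtain a1 ax ay axy ayx axyx c1 cx cy cxy cyx cxyx
    where v: "v = ((a1, ax, ay, axy, ayx, axyx), (c1, cx, cy, cxy, cyx, cxyx))"
    by (rule pair_cases)
  show "v \<in> hkhi_bounds 0 \<longleftrightarrow> v \<in> {v \<in> pairs 0. fst (fst v) = 0}"
  proof
    assume "v \<in> hkhi_bounds 0"
    then obtain w u where "v = b_pair 1 w + cap_pair 1 u"
      by (rule hkhi_boundsE[of _ _ 1]) simp_all
    then show "v \<in> {v \<in> pairs 0. fst (fst v) = 0}"
      by (cases w rule: pair_cases; cases u rule: pair_cases)
        (simp add: b_pair_1 cap_pair_1 pairs_def del: One_nat_def)
  next
    assume "v \<in> {v \<in> pairs 0. fst (fst v) = 0}"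
    then have *: "a1 = 0" "(c1, cx, cy, cxy, cyx, cxyx) = 0"
      by (simp_all add: v pairs_def)
    \<comment> \<open>Cap sends 1 \<otimes> x, 1 \<otimes> y and y \<otimes> y to x, y and xy. The
      boundary of -x \<otimes> y is yx - xy, which explains the coefficient
      \<open>axy + ayx\<close>, and the boundary of xy \<otimes> x is xyx.\<close>
    let ?u = "((ax, 0, 0, 0, 0, 0), (ay, 0, axy + ayx, 0, 0, 0)) :: 'k pair"
    have "v = b_pair 1 ((0, 0, 0, axyx, 0, 0), (0, - ayx, 0, 0, 0, 0)) + cap_pair 1 ?u"
      unfolding v * b_pair_1 cap_pair_1 by simp
    moreover have "((0, 0, 0, axyx, 0, 0), (0, - ayx, 0, 0, 0, 0)) \<in> pairs 1"
      by (simp add: pairs_iff)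
    moreover have "?u \<in> hk_cycles 1"
      unfolding hk_cycles_def mem_Collect_eq b_pair_1 by (simp add: pairs_def zero_prod_def)
    ultimately show "v \<in> hkhi_bounds 0"
      by (rule hkhi_boundsI) simp
  qed
qed

text \<open>This is injectivity of cap on Koszul homology in degree 1. The equations for a cycle and
  for its cap being a boundary together force a Koszul boundary, so the cap part of the witness is
  0.\<close>

lemma hkhi_1:
  fixes v :: "'k::field_char_0 pair"
  assumes "v \<in> hk_cycles 1" "cap_pair 1 v \<in> hk_bounds 0"
  shows "v \<in> hkhi_bounds 1"
proof -
  obtain a1 ax ay axy ayx axyx c1 cx cy cxy cyx cxyx
    where v: "v = ((a1, ax, ay, axy, ayx, axyx), (c1, cx, cy, cxy, cyx, cxyx))"
    by (rule pair_cases)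
  have "b_pair 1 v = 0"
    using assms(1) by (simp only: hk_cycles_def mem_Collect_eq)
  then have "cx - ay = 0" "axy - ayx - cyx = 0"
    unfolding v b_pair_1 zero_prod_def by (simp_all only: prod.inject)
  then have cycle: "ay = cx" "axy = ayx + cyx"
    by (simp_all add: diff_diff_eq)
  obtain w where "cap_pair 1 v = b_pair 1 w"
    using assms(2) unfolding hk_bounds_def by auto
  \<comment> \<open>A boundary in degree 0 has no coefficients at x and y, and opposite ones at xy
    and yx. The latter says cx + cy = -cx, using \<open>ay = cx\<close>.\<close>
  then have cap: "a1 = 0" "c1 = 0" "cy = - (2 * cx)"
    unfolding v by (cases w rule: pair_cases; simp add: b_pair_1 cap_pair_1 cycle del: One_nat_def;
      simp add: algebra_simps)+
  \<comment> \<open>These solve X + 2Y = \<open>cxy\<close> and X - Y = \<open>cyx\<close>, the xy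
    and yx coordinates of the second component of \<open>b_pair_2\<close>. The determinant is
    -3.\<close>
  let ?y = "(cxy - cyx) / 3" and ?x = "(cxy + 2 * cyx) / 3"
  have "v = b_pair 2 ((ax / 2, 0, axy + ?y, axyx + cxyx, 0, 0), (- cx, ?x, ?y, 0, cxyx, 0)) + cap_pair 2 0"
    unfolding v b_pair_2 by (simp add: cycle cap cap_pair_def field_simps)
  moreover have "((ax / 2, 0, axy + ?y, axyx + cxyx, 0, 0), (- cx, ?x, ?y, 0, cxyx, 0)) \<in> pairs 2"
    by (simp add: pairs_iff)
  moreover have "0 \<in> hk_cycles 2"
    using presentation.zero_S[OF presentation_HK] .
  ultimately show ?thesis
    by (rule hkhi_boundsI) simp
qed

lemma hkhi_bounds_2: "hkhi_bounds 2 = {((0, r, 0, - s, s, t), 0 :: 'k::field six) | r s t. True}"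
proof (rule Set.set_eqI)
  fix v :: "'k pair"
  show "v \<in> hkhi_bounds 2 \<longleftrightarrow> v \<in> {((0, r, 0, - s, s, t), 0) | r s t. True}"
  proof
    assume "v \<in> hkhi_bounds 2"
    then obtain w u where wu: "v = b_pair 3 w + cap_pair 3 u" "u \<in> hk_cycles 3"
      by (rule hkhi_boundsE[of _ _ 3]) simp_all
    obtain a1 ax ay axy ayx axyx and c :: "'k six" where u: "u = ((a1, ax, ay, axy, ayx, axyx), c)"
      by (metis surj_pair)
    \<comment> \<open>Without this, cap could add to the xy coordinate alone and break the opposite
      coefficients -s and s.\<close>
    have "ay = 0"
      using wu(2) unfolding u hk_cycles_def by (simp add: b_pair_ge_3 zero_prod_def)
    then show "v \<in> {((0, r, 0, - s, s, t), 0) | r s t. True}"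
      using wu(1) unfolding u by (cases w rule: pair_cases) (simp add: b_pair_ge_3 cap_pair_ge_3)
  next
    assume "v \<in> {((0, r, 0, - s, s, t), 0) | r s t. True}"
    then obtain r s t where v: "v = ((0, r, 0, - s, s, t), 0)"
      by blast
    \<comment> \<open>Cap of 1 \<otimes> x^3 gives x \<otimes> x^2. The boundaries of y \<otimes>
      x^3 and xy \<otimes> x^3 give (yx - xy) \<otimes> x^2 and xyx \<otimes> x^2.\<close>
    let ?u = "((r, 0, 0, 0, 0, 0), 0) :: 'k pair"
    have "v = b_pair 3 ((0, 0, s, t, 0, 0), 0) + cap_pair 3 ?u"
      by (simp add: v b_pair_ge_3 cap_pair_ge_3)
    moreover have "((0, 0, s, t, 0, 0), 0) \<in> pairs 3"
      by (simp add: pairs_iff)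
    moreover have "?u \<in> hk_cycles 3"
      by (simp add: hk_cycles_def pairs_def b_pair_ge_3 zero_prod_def)
    ultimately show "v \<in> hkhi_bounds 2"
      by (rule hkhi_boundsI) simp
  qed
qed

abbreviation "pair_z1 \<equiv> ((0, 0, 0, 0, 1, 0), (0, 0, 0, 1, 1, 0))"

abbreviation "pair_z2 \<equiv> ((0, 0, 0, 0, 0, 0), (0, 0, 0, 0, 0, 1))"

lemma pair_z_cycles:
  "pair_z1 \<in> (hk_cycles 2 :: 'k::field pair set)"
  "cap_pair 2 pair_z1 \<in> (hk_bounds 1 :: 'k pair set)"
  "pair_z2 \<in> (hk_cycles 2 :: 'k pair set)"
  "cap_pair 2 pair_z2 \<in> (hk_bounds 1 :: 'k pair set)"
proof -
  show "pair_z1 \<in> (hk_cycles 2 :: 'k pair set)" "pair_z2 \<in> (hk_cycles 2 :: 'k pair set)"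
    unfolding hk_cycles_def mem_Collect_eq b_pair_2 by (simp_all add: pairs_def zero_prod_def)
  \<comment> \<open>The cap product is -xyx \<otimes> y, nonzero as a chain. It is the boundary of
    xy \<otimes> (y^2 - xy), because yxy = 0.\<close>
  have "cap_pair 2 pair_z1 = b_pair 2 ((0, (0, 0, 0, 1, 0, 0)) :: 'k pair)"
    unfolding zero_prod_def b_pair_2 cap_pair_2 by simp
  then show "cap_pair 2 pair_z1 \<in> (hk_bounds 1 :: 'k pair set)"
    unfolding hk_bounds_def Suc_1 by (rule image_eqI) (simp add: pairs_def)
  have "cap_pair 2 pair_z2 = b_pair 2 (0 :: 'k pair)"
    unfolding zero_prod_def b_pair_2 cap_pair_2 by simp
  then show "cap_pair 2 pair_z2 \<in> (hk_bounds 1 :: 'k pair set)"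
    unfolding hk_bounds_def Suc_1 by (rule image_eqI) (simp add: pairs_closed)
qed

lemma hk_cycles_2_decomp:
  fixes v :: "'k::field_char_0 pair"
  assumes "v \<in> hk_cycles 2"
  shows "\<exists>a b. v - (pair_scale a pair_z1 + pair_scale b pair_z2) \<in> hkhi_bounds 2"
proof -
  obtain a1 ax ay axy ayx axyx c1 cx cy cxy cyx cxyx
    where v: "v = ((a1, ax, ay, axy, ayx, axyx), (c1, cx, cy, cxy, cyx, cxyx))"
    by (rule pair_cases)
  have *: "a1 = 0" "c1 = 0" "ay = cy" "cx = cy" "cx + 2 * cy = 0" "axy + ayx = cyx" "cyx = cxy"
    using assms unfolding v hk_cycles_def mem_Collect_eq b_pair_2 by (auto simp: zero_prod_def)
  \<comment> \<open>The coordinates of the cycle equation give cx = cy and cx + 2cy = 0;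
    characteristic zero then removes both unknowns.\<close>
  then have "3 * cy = 0"
    by simp
  then have cy: "cy = 0"
    by (simp only: mult_eq_0_iff) simp
  have "v - (pair_scale cyx pair_z1 + pair_scale cxyx pair_z2) = ((0, ax, 0, - (ayx - cyx), ayx - cyx, axyx), 0)"
    using *(6) by (simp add: v pair_scale_def six_scale_def * cy zero_prod_def) (simp add: algebra_simps flip: *(6,7))
  then show ?thesis
    unfolding hkhi_bounds_2 by blast
qed

text \<open>Everything in \<open>hkhi_bounds 2\<close> has second component 0, while the two
  generators have the independent second components xy + yx and xyx.\<close>

lemma pair_z_indep:
  "pair_scale a pair_z1 + pair_scale b pair_z2 \<in> hkhi_bounds 2 \<Longrightarrow> a = 0 \<and> b = 0"
  unfolding hkhi_bounds_2 by (auto simp: pair_scale_def six_scale_def zero_prod_def)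

text \<open>The parity of p decides. For odd p the cap condition excludes 1 \<otimes> x^p, and the
  remaining cycles are Koszul boundaries. For even p the class of x \<otimes> x^p is removed only by
  cap, from 1 \<otimes> x^(p+1).\<close>

lemma hkhi_ge_3:
  fixes v :: "'k::field_char_0 pair"
  assumes p: "p \<ge> 3" and v: "v \<in> hk_cycles p" and cap: "cap_pair p v \<in> hk_bounds (p - 1)"
  shows "v \<in> hkhi_bounds p"
proof -
  obtain a1 ax ay axy ayx axyx and c :: "'k six" where v_eq: "v = ((a1, ax, ay, axy, ayx, axyx), c)"
    by (metis surj_pair)
  have c: "c = 0"
    using v p by (auto simp: v_eq hk_cycles_def pairs_def)
  show ?thesis
  proof (cases "odd p")
    case True
    \<comment> \<open>Boundaries in degree p - 1 come from degree p, since p is positive. For odd p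
      these boundaries have no x coordinate, whereas that of the cap product is
      \<open>a1\<close>.\<close>
    obtain w where w: "cap_pair p v = b_pair p w"
      using cap p unfolding hk_bounds_def by auto
    have "a1 = 0"
      using w p True unfolding v_eq by (cases w rule: pair_cases) (simp add: b_pair_ge_3 cap_pair_ge_3)
    moreover have "ay = 0" "axy = ayx"
      using v p True by (auto simp: v_eq hk_cycles_def b_pair_ge_3 zero_prod_def)
    \<comment> \<open>Degree p + 1 is even, so the x coordinate of the boundary is twice that of 1;
      hence the half.\<close>
    ultimately have "v = b_pair (Suc p) ((ax / 2, 0, axy, axyx, 0, 0), 0) + cap_pair (Suc p) 0"
      using p True by (simp add: v_eq c b_pair_ge_3 cap_pair_def)
    moreover have "((ax / 2, 0, axy, axyx, 0, 0), 0) \<in> pairs (Suc p)"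
      by (simp add: pairs_iff)
    moreover have "0 \<in> hk_cycles (Suc p)"
      using presentation.zero_S[OF presentation_HK] .
    ultimately show ?thesis
      by (rule hkhi_boundsI) simp
  next
    case False
    then have *: "a1 = 0" "ay = 0" "axy = - ayx"
      using v p by (auto simp: v_eq hk_cycles_def b_pair_ge_3 zero_prod_def eq_neg_iff_add_eq_0)
    \<comment> \<open>In the odd degree p + 1 the Koszul differential is a commutator with x, which
      kills 1 \<otimes> x^(p+1). This cycle is available to cap and maps to x \<otimes> x^p.\<close>
    let ?u = "((ax, 0, 0, 0, 0, 0), 0) :: 'k pair"
    have "v = b_pair (Suc p) ((0, 0, ayx, axyx, 0, 0), 0) + cap_pair (Suc p) ?u"
      using p False by (simp add: v_eq c * b_pair_ge_3 cap_pair_ge_3)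
    moreover have "((0, 0, ayx, axyx, 0, 0), 0) \<in> pairs (Suc p)"
      by (simp add: pairs_iff)
    moreover have "?u \<in> hk_cycles (Suc p)"
      using p False by (simp add: hk_cycles_def pairs_def b_pair_ge_3 zero_prod_def)
    ultimately show ?thesis
      by (rule hkhi_boundsI) simp
  qed
qed

lemma koszul_elem_2:
  "koszul_elem 2 (a, c) = pure_tensor rels (alg_of a) (word [Gx, Gx])
    \<oplus>\<^bsub>tensor_chains rels 2\<^esub> pure_tensor rels (alg_of c) (word [Gy, Gy] - word [Gx, Gy])"
proof -
  interpret T: presentation chain_scale
      "tensor_chains rels 2 :: ('a, gen list \<Rightarrow> (gen, 'a) tensor set) module"
      "{F. \<forall>w. length w \<noteq> 2 \<longrightarrow> F w = 0}" "{0}" chain_of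
    by (rule presentation_tensor_chains)
  have "chain 2 (a, c) = (\<lambda>w. six_scale (Poly_Mapping.lookup (word [Gx, Gx]) w) a)
      + (\<lambda>w. six_scale (Poly_Mapping.lookup (word [Gy, Gy] - word [Gx, Gy]) w) c)"
    by (simp add: chain_def W_gen_def fun_eq_iff numeral_2_eq_2)
  then show ?thesis
    by (simp only: pure_tensor_chain_of) (subst T.q_add, auto simp: lookup_word lookup_minus)
qed

lemma z1_elem: "z1 = koszul_elem 2 pair_z1"
  by (simp add: z1_def koszul_elem_2 coord_add flip: alg_class_eq)

text \<open>There is no x^2 summand in \<open>z2\<close>, so instead of splitting into two pure
  tensors its single one is compared with the chain coordinatewise.\<close>

lemma z2_elem: "z2 = koszul_elem 2 pair_z2"
proof -
  have z2: "z2 = chain_of (\<lambda>w. six_scale (Poly_Mapping.lookup (word [Gy, Gy] - word [Gx, Gy]) w)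
      (0, 0, 0, 0, 0, 1 :: 'a))"
    by (simp add: z2_def flip: alg_class_eq pure_tensor_chain_of)
  have "chain 2 pair_z2 = (\<lambda>w. six_scale (Poly_Mapping.lookup (word [Gy, Gy] - word [Gx, Gy]) w)
      (0, 0, 0, 0, 0, 1 :: 'a))"
    by (simp add: chain_def W_gen_def fun_eq_iff six_scale_def)
  then show ?thesis
    by (simp only: z2)
qed

theorem proposition9p3:
  fixes R :: "(gen, 'k::field_char_0) tensor set"
  defines "R \<equiv> rels"
  shows
    "vs_iso (HKhi R 0) (line_space :: ('k, 'k) module)
     \<and> vs_iso (HKhi R 1) (zero_space :: ('k, 'k) module)
     \<and> (z1 \<in> carrier (cycles (koszul_chains R) (koszul_b R) 2)
        \<and> z2 \<in> carrier (cycles (koszul_chains R) (koszul_b R) 2)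
        \<and> vectorspace scalars (HKhi R 2)
        \<and> vectorspace.fin_dim scalars (HKhi R 2)
        \<and> vectorspace.dim scalars (HKhi R 2) = 2
        \<and> HKhi_class R 2 (HK_class R 2 z1) \<in> carrier (HKhi R 2)
        \<and> HKhi_class R 2 (HK_class R 2 z2) \<in> carrier (HKhi R 2)
        \<and> LinearCombinations.module.span scalars (HKhi R 2)
            {HKhi_class R 2 (HK_class R 2 z1), HKhi_class R 2 (HK_class R 2 z2)}
          = carrier (HKhi R 2))
     \<and> (\<forall>p\<ge>3. vs_iso (HKhi R p) (zero_space :: ('k, 'k) module))"
proof -
  let ?Z = "\<lambda>p. {v :: 'k pair. v \<in> hk_cycles p \<and> cap_pair p v \<in> hk_bounds (p - 1)}"
  let ?q = "\<lambda>p (v :: 'k pair). HKhi_class R p (HK_class R p (koszul_elem p v))"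
  have P: "presentation pair_scale (HKhi R p) (?Z p) (hkhi_bounds p) (?q p)" for p
    using presentation_HKhi[of p] unfolding hkhi_bounds_def R_def .
  have "vs_iso (HKhi R 0) (line_space :: ('k, 'k) module)"
  proof (rule presentation.vs_iso_line[OF P])
    show "fst (fst (v + w)) = fst (fst v) + fst (fst w)" for v w :: "'k pair"
      by simp
    show "fst (fst (pair_scale c v)) = c * fst (fst v)" for c and v :: "'k pair"
      by (simp add: pair_scale_def six_scale_def case_prod_unfold)
    \<comment> \<open>Both maps vanish in degree 0, so neither the cycle condition nor the cap
      condition restricts v.\<close>
    have Z: "v \<in> ?Z 0 \<longleftrightarrow> v \<in> pairs 0" for v
    proof -
      have "b_pair 0 v = 0" "cap_pair 0 v = 0"
        by (simp_all add: b_pair_def right_pair_def cap_pair_def)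
      then show ?thesis
        using presentation.zero_K[OF presentation_HK[where 'k = 'k], of 0] by (simp add: hk_cycles_def)
    qed
    show "hkhi_bounds 0 = {v \<in> ?Z 0. fst (fst v) = 0}"
      using Z unfolding hkhi_bounds_0 by blast
    show "((1, 0, 0, 0, 0, 0), 0) \<in> ?Z 0"
      unfolding Z by (simp add: pairs_def)
  qed simp
  moreover have "vs_iso (HKhi R 1) (zero_space :: ('k, 'k) module)"
    by (rule presentation.vs_iso_zero[OF P], rule subsetI, rule hkhi_1) (simp_all del: One_nat_def)
  moreover have "\<forall>p\<ge>3. vs_iso (HKhi R p) (zero_space :: ('k, 'k) module)"
    by (intro allI impI presentation.vs_iso_zero[OF P] subsetI hkhi_ge_3) simp_all
  moreover have "koszul_elem 2 v \<in> carrier (cycles (koszul_chains R) (koszul_b R) 2)"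
    if "v \<in> hk_cycles 2" for v :: "'k pair"
  proof -
    have "presentation pair_scale (cycles (koszul_chains rels) (koszul_b rels) 2)
        {v \<in> pairs 2. b_pair 2 v \<in> {0}} {0} (koszul_elem 2 :: 'k pair \<Rightarrow> _)"
      by (rule cycles_presentation[OF presentation_koszul_chains presentation_koszul_chains])
        (simp_all add: koszul_b_elem pair_maps_closed(2)[of _ 2, simplified] b_pair_linear)
    from presentation.q_closed[OF this, of v] show ?thesis
      using that by (simp add: hk_cycles_def R_def)
  qed
  moreover have z: "pair_z1 \<in> ?Z 2" "pair_z2 \<in> ?Z 2"
    using pair_z_cycles by simp_all
  moreover have "vectorspace.fin_dim scalars (HKhi R 2) \<and> vectorspace.dim scalars (HKhi R 2) = 2
      \<and> LinearCombinations.module.span scalars (HKhi R 2) {?q 2 pair_z1, ?q 2 pair_z2} = carrier (HKhi R 2)"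
    by (rule presentation.two_dimensional[OF P z]) (use hk_cycles_2_decomp pair_z_indep in blast)+
  ultimately show ?thesis
    using presentation.vectorspace_H[OF P, of 2] presentation.q_closed[OF P z(1)] presentation.q_closed[OF P z(2)]
    unfolding z1_elem z2_elem by blast
qed

end
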